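(* Let $\mathcal{E}$ be the ensemble of symplectic matrices on $n$ qubits drawn from the two-layer superblock architecture, with two layers of $m/2=n/(2\xi)$ superblocks each, where $\xi=O(\log(k^2n/\epsilon))$ (i.e. $\xi$ is a sufficiently large choice of this order). This ensemble anti-concentrates, i.e. $$\mathbb{E}_{U\sim\mathcal{E}}|\langle0^n|U|0^n\rangle|^{2k}\le(1+\epsilon)\,\mathbb{E}_{U\sim\mathrm{USp}(2^n)}|\langle0^n|U|0^n\rangle|^{2k},$$ where on the right $U$ is Haar-random in $\mathrm{USp}(2^n)$.
   Context: The unitary symplectic group on $n$ qubits is $\mathrm{USp}(2^n)=\{U\in\mathrm{U}(2^n):UJU^T=J\}$, where $J$ is a symplectic form, i.e. a unitary matrix with $J^T=J^\dagger=-J$. The standing choice is $J=i^n\bigotimes_{j=1}^nY_j$ with $n$ odd, where $Y_j$ is the Pauli-$Y$ matrix on qubit $j$; all choices of $J$ are equal up to a basis change. Two-layer superblock architecture: $n$ qubits on a line (with periodic boundary conditions) are divided into $m=n/\xi$ consecutive patches of $\xi$ qubits, $m$ even. In the first layer, random unitaries ("superblocks") are applied to the pairs of patches $(1,2),(3,4),\dots,(m-1,m)$; in the second layer, to the pairs $(2,3),(4,5),\dots,(m,1)$. The superblocks, each acting on $2\xi$ qubits, are drawn independently from the Haar measure of the unitary symplectic group on the qubits of the superblock.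
   Formalization: The relative error is restricted to 0 < ε ≤ 1; with ε unbounded the claim fails (k = 2, ε = n, fixed ξ, m large), while 1 < ε ≤ √(k²n) follows from the case ε = 1 after doubling the constant in ξ = O(log(k²n/ε)). *)

theory Defs
  imports "HOL-Probability.Probability" "Jordan_Normal_Form.Schur_Decomposition"
begin

definition unitary_mat :: "complex mat \<Rightarrow> bool" where
  "unitary_mat U \<longleftrightarrow> square_mat U \<and>
     U * mat_adjoint U = 1\<^sub>m (dim_row U) \<and> mat_adjoint U * U = 1\<^sub>m (dim_row U)"

definition symplectic_form :: "nat \<Rightarrow> complex mat \<Rightarrow> bool" where
  "symplectic_form N J \<longleftrightarrow> J \<in> carrier_mat N N \<and> unitary_mat J \<and>
     transpose_mat J = mat_adjoint J \<and> mat_adjoint J = - J"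

definition USp :: "nat \<Rightarrow> complex mat \<Rightarrow> complex mat set" where
  "USp N J = {U \<in> carrier_mat N N. unitary_mat U \<and> U * J * transpose_mat U = J}"

text \<open>The type of matrices carries no topology, so the Borel \<open>\<sigma>\<close>-algebra of
  \<open>N \<times> N\<close> matrices is the one generated by the entries.\<close>

definition mat_space :: "nat \<Rightarrow> complex mat measure" where
  "mat_space N = vimage_algebra (carrier_mat N N)
     (\<lambda>A. \<lambda>ij \<in> {..<N} \<times> {..<N}. A $$ ij)
     (\<Pi>\<^sub>M ij \<in> {..<N} \<times> {..<N}. (borel :: complex measure))"

text \<open>For a closed subgroup \<open>G\<close> of the unitary group, compactness of \<open>G\<close> implies that exactly
  one measure satisfies the following predicate.\<close>

definition is_haar :: "nat \<Rightarrow> complex mat set \<Rightarrow> complex mat measure \<Rightarrow> bool" where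
  "is_haar N G \<mu> \<longleftrightarrow> prob_space \<mu> \<and>
     space \<mu> = G \<and> sets \<mu> = sets (restrict_space (mat_space N) G) \<and>
     (\<forall>g\<in>G. distr \<mu> \<mu> (\<lambda>U. g * U) = \<mu> \<and> distr \<mu> \<mu> (\<lambda>U. U * g) = \<mu>)"

text \<open>Qubits are numbered from \<open>0\<close>, and \<open>x < 2 ^ n\<close> labels the computational basis
  state in which qubit \<open>q\<close> has the value \<open>bit x q\<close>; in particular the label of
  \<open>|0\<^sup>n\<rangle>\<close> is \<open>0\<close>. For a list \<open>qs\<close> of distinct qubits, \<open>sub_label qs x\<close> is
  the label of the state of these qubits alone (the \<open>l\<close>-th element of \<open>qs\<close> becoming
  qubit \<open>l\<close>), and \<open>on_qubits n qs V\<close> is \<open>V\<close> acting on them, tensored with the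
  identity on the other qubits.\<close>

definition sub_label :: "nat list \<Rightarrow> nat \<Rightarrow> nat" where
  "sub_label qs x = (\<Sum>l<length qs. of_bool (bit x (qs ! l)) * 2 ^ l)"

definition on_qubits :: "nat \<Rightarrow> nat list \<Rightarrow> complex mat \<Rightarrow> complex mat" where
  "on_qubits n qs V = Matrix.mat (2 ^ n) (2 ^ n)
     (\<lambda>(x, y). if \<forall>q<n. q \<notin> set qs \<longrightarrow> bit x q = bit y q
               then V $$ (sub_label qs x, sub_label qs y) else 0)"

definition patch :: "nat \<Rightarrow> nat \<Rightarrow> nat list" where
  "patch \<xi> p = [p * \<xi> ..< Suc p * \<xi>]"

text \<open>With patches numbered from \<open>0\<close> to \<open>m - 1\<close>, superblock \<open>s < m\<close> acts on the patches
  \<open>s\<close> and \<open>s + 1\<close> (modulo \<open>m\<close>). Hence the superblocks with even \<open>s\<close> form the first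
  layer and those with odd \<open>s\<close> the second. Within a layer they have disjoint supports, so
  the order of the product in \<open>layer\<close> is irrelevant.\<close>

definition superblock_qubits :: "nat \<Rightarrow> nat \<Rightarrow> nat \<Rightarrow> nat list" where
  "superblock_qubits m \<xi> s = patch \<xi> s @ patch \<xi> (Suc s mod m)"

definition layer :: "nat \<Rightarrow> nat \<Rightarrow> (nat \<Rightarrow> complex mat) \<Rightarrow> nat list \<Rightarrow> complex mat" where
  "layer m \<xi> V ss =
     foldr (\<lambda>s A. on_qubits (m * \<xi>) (superblock_qubits m \<xi> s) (V s) * A) ss (1\<^sub>m (2 ^ (m * \<xi>)))"

definition two_layer_circuit :: "nat \<Rightarrow> nat \<Rightarrow> (nat \<Rightarrow> complex mat) \<Rightarrow> complex mat" where
  "two_layer_circuit m \<xi> V =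
     layer m \<xi> V (filter odd [0..<m]) * layer m \<xi> V (filter even [0..<m])"

text \<open>The distribution of the circuit when superblock \<open>s\<close> is drawn from \<open>\<nu> s\<close>, all
  superblocks being independent.\<close>

definition superblock_ensemble ::
  "nat \<Rightarrow> nat \<Rightarrow> (nat \<Rightarrow> complex mat measure) \<Rightarrow> complex mat measure" where
  "superblock_ensemble m \<xi> \<nu> =
     distr (\<Pi>\<^sub>M s \<in> {..<m}. \<nu> s) (mat_space (2 ^ (m * \<xi>))) (two_layer_circuit m \<xi>)"

definition zero_amplitude_moment :: "complex mat measure \<Rightarrow> nat \<Rightarrow> real" where
  "zero_amplitude_moment M k = (\<integral>U. (cmod (U $$ (0, 0))) ^ (2 * k) \<partial>M)"

end

theory Submission
  imports Defs
begin

text \<open>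
  \<open>USp(N)\<close> acts transitively on the unit sphere, so rows and columns of a Haar matrix are isotropic:
  the \<open>2k\<close>-th moment of their pairing with \<open>x\<close> is \<open>c \<parallel>x\<parallel>\<^sup>2\<^sup>k\<close>, where
  \<open>c = k! / (N (N + 1) \<dots> (N + k - 1))\<close> is the Haar moment itself. With \<open>D = 2\<^sup>\<xi>\<close>, the circuit
  amplitude is the trace of a product of \<open>m\<close> independent \<open>D \<times> D\<close> matrices \<open>M\<^sub>s\<close>, each an isotropic
  vector of length \<open>D\<^sup>2\<close>. Averaging over \<open>M\<^sub>0\<close> replaces the trace by \<open>c \<parallel>M\<^sub>1 \<dots> M\<^sub>m\<^sub>-\<^sub>1\<parallel>\<^sup>2\<^sup>k\<close> in Frobenius
  norm. By convexity over the columns of \<open>Y\<close>, \<open>E \<parallel>M Y\<parallel>\<^sup>2\<^sup>k \<le> r \<parallel>Y\<parallel>\<^sup>2\<^sup>k\<close> with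
  \<open>r = \<Prod>i<k. (D + i) / (D\<^sup>2 + i) \<le> D\<^sup>-\<^sup>k exp (k\<^sup>2 / D)\<close>. In total the ratio to the Haar
  moment is at most \<open>exp (m k\<^sup>2 / D)\<close>.
\<close>

section \<open>Transitivity of the unitary symplectic group on spheres\<close>

text \<open>Transitivity on spheres is the only input from the group: it fixes every moment of a
  linear functional of one row or column up to a constant, so no Weingarten calculus is involved and
  any symplectic form \<open>J\<close> will do. The averages over M_0 (the trace is linear in it)
  and over M_s y for a single vector y are exact. The obstacle is M_s Y for a matrix Y: all columns
  of Y are hit by the same M_s, so their images are dependent, and only an upper bound is available.
  The bound still has the right leading order. The constant c contributes at most k! D^(-2k), the m
  - 1 factors r contribute D^(-k(m-1)), and the empty chain, an identity matrix of squared Frobenius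
  norm D, contributes D^k. The total k! D^(-mk) is the leading term of the Haar moment in dimension
  D^m, so only the exponential corrections have to be made small by the choice of \<xi>.\<close>

lemma mat_adjoint_carrier: "A \<in> carrier_mat n m \<Longrightarrow> mat_adjoint A \<in> carrier_mat m n"
  by (auto simp: mat_adjoint_def)

lemma mat_adjoint_index:
  "i < dim_col A \<Longrightarrow> j < dim_row A \<Longrightarrow> mat_adjoint A $$ (i, j) = cnj (A $$ (j, i))"
  by (simp add: mat_adjoint_def mat_of_rows_def)

lemma mult_mat_index_sum:
  "A \<in> carrier_mat n m \<Longrightarrow> B \<in> carrier_mat m l \<Longrightarrow> i < n \<Longrightarrow> j < l \<Longrightarrow>
   (A * B) $$ (i, j) = (\<Sum>c<m. A $$ (i, c) * B $$ (c, j))"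
  by (auto simp: scalar_prod_def lessThan_atLeast0)

lemma unitary_matI:
  assumes U: "U \<in> carrier_mat N N"
    and rows: "\<And>a b. a < N \<Longrightarrow> b < N \<Longrightarrow> (\<Sum>c<N. U $$ (a, c) * cnj (U $$ (b, c))) = of_bool (a = b)"
  shows "unitary_mat U"
proof -
  have ad: "mat_adjoint U \<in> carrier_mat N N" using U by (rule mat_adjoint_carrier)
  have e: "U * mat_adjoint U = 1\<^sub>m N"
  proof (rule eq_matI)
    fix i j assume "i < dim_row (1\<^sub>m N :: complex mat)" "j < dim_col (1\<^sub>m N :: complex mat)"
    hence ij: "i < N" "j < N" by auto
    have "(U * mat_adjoint U) $$ (i, j) = (\<Sum>c<N. U $$ (i, c) * cnj (U $$ (j, c)))"
      unfolding mult_mat_index_sum[OF U ad ij] using U ij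
      by (intro sum.cong) (auto simp: mat_adjoint_index)
    thus "(U * mat_adjoint U) $$ (i, j) = 1\<^sub>m N $$ (i, j)"
      using rows[OF ij] ij by simp
  qed (use U ad in auto)
  have "mat_adjoint U * U = 1\<^sub>m N"
    using mat_mult_left_right_inverse[OF U ad e] .
  thus ?thesis using e U by (auto simp: unitary_mat_def)
qed

lemma unitary_mat_rows:
  assumes "unitary_mat U" and U: "U \<in> carrier_mat N N" and ab: "a < N" "b < N"
  shows "(\<Sum>c<N. U $$ (a, c) * cnj (U $$ (b, c))) = of_bool (a = b)"
proof -
  have "(U * mat_adjoint U) $$ (a, b) = (\<Sum>c<N. U $$ (a, c) * cnj (U $$ (b, c)))"
    unfolding mult_mat_index_sum[OF U mat_adjoint_carrier[OF U] ab] using U ab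
    by (intro sum.cong) (auto simp: mat_adjoint_index)
  thus ?thesis using assms by (auto simp: unitary_mat_def)
qed

lemma unitary_mat_cols:
  assumes "unitary_mat U" and U: "U \<in> carrier_mat N N" and ab: "a < N" "b < N"
  shows "(\<Sum>c<N. cnj (U $$ (c, a)) * U $$ (c, b)) = of_bool (a = b)"
proof -
  have "(mat_adjoint U * U) $$ (a, b) = (\<Sum>c<N. cnj (U $$ (c, a)) * U $$ (c, b))"
    unfolding mult_mat_index_sum[OF mat_adjoint_carrier[OF U] U ab] using U ab
    by (intro sum.cong) (auto simp: mat_adjoint_index)
  thus ?thesis using assms by (auto simp: unitary_mat_def)
qed

text \<open>Transpose equal to adjoint says that \<open>J\<close> is entrywise real; with
  antisymmetry, unitarity then reads J^2 = -1.\<close>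

lemma symplectic_formD:
  assumes "symplectic_form N J" and "a < N" and "b < N"
  shows "J $$ (b, a) = - J $$ (a, b)"
    and "cnj (J $$ (a, b)) = J $$ (a, b)"
    and "(\<Sum>c<N. J $$ (a, c) * J $$ (c, b)) = - of_bool (a = b)"
proof -
  have J: "J \<in> carrier_mat N N" and un: "unitary_mat J"
    and tr: "transpose_mat J = mat_adjoint J" and ad: "mat_adjoint J = - J"
    using assms by (auto simp: symplectic_form_def)
  have anti: "J $$ (y, x) = - J $$ (x, y)" if "x < N" "y < N" for x y
  proof -
    have "transpose_mat J $$ (x, y) = (- J) $$ (x, y)" using tr ad by simp
    thus ?thesis using that J by simp
  qed
  have real: "cnj (J $$ (x, y)) = J $$ (x, y)" if "x < N" "y < N" for x y
    using arg_cong[OF tr, where f="\<lambda>A. A $$ (y, x)"] that J by (simp add: mat_adjoint_index)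
  show "J $$ (b, a) = - J $$ (a, b)" "cnj (J $$ (a, b)) = J $$ (a, b)"
    using anti[OF assms(2,3)] real[OF assms(2,3)] by auto
  have "(\<Sum>c<N. J $$ (a, c) * J $$ (c, b)) = (\<Sum>c<N. - (J $$ (a, c) * cnj (J $$ (b, c))))"
    using assms by (intro sum.cong refl) (simp add: real anti[OF assms(3)])
  thus "(\<Sum>c<N. J $$ (a, c) * J $$ (c, b)) = - of_bool (a = b)"
    using unitary_mat_rows[OF un J assms(2,3)] by (simp add: sum_negf)
qed

text \<open>The witness is a quaternionic reflection: \<open>x \<mapsto> J (cnj x)\<close> is a quaternionic structure commuting with
  \<open>USp N J\<close>, and \<open>g = 1 - y y\<^sup>* / z - w w\<^sup>* / cnj z\<close> for \<open>y = u - v\<close>, \<open>w = J (cnj y)\<close> and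
  \<open>z = y\<^sup>* u\<close>. The hypothesis \<open>u\<^sup>T J v = 0\<close> says that \<open>w\<close> is orthogonal to \<open>u\<close>.\<close>

lemma symplectic_reflection:
  assumes J: "symplectic_form N J"
    and norm: "(\<Sum>a<N. u a * cnj (u a)) = (\<Sum>a<N. v a * cnj (v a))"
    and iso: "(\<Sum>a<N. \<Sum>b<N. u a * J $$ (a, b) * v b) = 0"
  shows "\<exists>g\<in>USp N J. \<forall>a<N. (\<Sum>b<N. g $$ (a, b) * u b) = v a"
proof -
  define y where "y a = u a - v a" for a
  define w where "w a = (\<Sum>c<N. J $$ (a, c) * cnj (y c))" for a
  define z where "z = (\<Sum>a<N. cnj (y a) * u a)"
  define Y where "Y = (\<Sum>a<N. y a * cnj (y a))"
  define p q where "p = 1 / z" and "q = 1 / cnj z"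
  have Jc: "J \<in> carrier_mat N N" using J by (simp add: symplectic_form_def)
  note Jf = symplectic_formD[OF J]
  have alt: "(\<Sum>a<N. \<Sum>b<N. x a * J $$ (a, b) * x b) = 0" for x
  proof -
    have "(\<Sum>a<N. \<Sum>b<N. x a * J $$ (a, b) * x b) = (\<Sum>a<N. \<Sum>b<N. x b * J $$ (b, a) * x a)"
      by (rule sum.swap)
    also have "\<dots> = (\<Sum>a<N. \<Sum>b<N. - (x a * J $$ (a, b) * x b))"
    proof (intro sum.cong refl)
      fix a b assume "a \<in> {..<N}" "b \<in> {..<N}"
      thus "x b * J $$ (b, a) * x a = - (x a * J $$ (a, b) * x b)" by (simp add: Jf(1)[of a b])
    qed
    finally show ?thesis by (simp add: sum_negf)
  qed
  \<comment> \<open>Equality of the norms of \<open>u\<close> and \<open>v\<close> enters here, as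
    |y|^2 = 2 Re (y* u). This becomes the relation \<open>p + q = Y * p * q\<close>, which is
    exactly unitarity of \<open>g\<close> on the span of the orthogonal vectors \<open>y\<close> and
    \<open>w\<close> of equal length.\<close>
  have Yz: "Y = z + cnj z"
  proof -
    have "z + cnj z = (\<Sum>a<N. cnj (y a) * u a + y a * cnj (u a))"
      unfolding z_def by (simp add: sum.distrib)
    also have "\<dots> = (\<Sum>a<N. y a * cnj (y a) + (u a * cnj (u a) - v a * cnj (v a)))"
      unfolding y_def by (intro sum.cong refl) (simp add: algebra_simps)
    also have "\<dots> = Y" using norm by (simp add: sum.distrib sum_subtractf Y_def)
    finally show ?thesis ..
  qed
  have cw: "cnj (w a) = (\<Sum>c<N. J $$ (a, c) * y c)" if "a < N" for a
    unfolding w_def cnj_sum using Jf(2) that by (intro sum.cong) auto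
  have yw: "(\<Sum>a<N. y a * cnj (w a)) = 0"
    using alt[of y] by (simp add: cw sum_distrib_left mult.assoc)
  have wy: "(\<Sum>a<N. w a * cnj (y a)) = 0"
    using arg_cong[OF yw, where f=cnj] by (simp add: cnj_sum mult.commute)
  have Jw: "(\<Sum>c<N. J $$ (a, c) * cnj (w c)) = - y a" if "a < N" for a
  proof -
    have "(\<Sum>c<N. J $$ (a, c) * cnj (w c)) = (\<Sum>c<N. \<Sum>e<N. J $$ (a, c) * J $$ (c, e) * y e)"
      by (intro sum.cong) (auto simp: cw sum_distrib_left mult.assoc)
    also have "\<dots> = (\<Sum>e<N. (\<Sum>c<N. J $$ (a, c) * J $$ (c, e)) * y e)"
      by (subst sum.swap) (simp add: sum_distrib_right)
    also have "\<dots> = (\<Sum>e<N. (- of_bool (a = e)) * y e)"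
      using Jf(3) that by (intro sum.cong) auto
    also have "\<dots> = - y a" using that by (simp add: sum_negf of_bool_def if_distrib[of "\<lambda>x. x * _"] cong: if_cong)
    finally show ?thesis .
  qed
  have ww: "(\<Sum>a<N. w a * cnj (w a)) = Y"
  proof -
    have "(\<Sum>a<N. w a * cnj (w a)) = (\<Sum>a<N. \<Sum>c<N. J $$ (a, c) * cnj (y c) * cnj (w a))"
      by (simp add: sum_distrib_right[symmetric] w_def[symmetric])
    also have "\<dots> = (\<Sum>c<N. \<Sum>a<N. J $$ (a, c) * cnj (y c) * cnj (w a))" by (rule sum.swap)
    also have "\<dots> = (\<Sum>c<N. - cnj (y c) * (\<Sum>a<N. J $$ (c, a) * cnj (w a)))"
      unfolding sum_distrib_left
    proof (intro sum.cong refl)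
      fix c a assume "c \<in> {..<N}" "a \<in> {..<N}"
      thus "J $$ (a, c) * cnj (y c) * cnj (w a) = - cnj (y c) * (J $$ (c, a) * cnj (w a))"
        by (simp add: Jf(1)[of c a])
    qed
    also have "\<dots> = Y" unfolding Y_def by (intro sum.cong) (simp_all add: Jw)
    finally show ?thesis .
  qed
  have wu: "(\<Sum>a<N. cnj (w a) * u a) = 0"
  proof -
    have "(\<Sum>a<N. cnj (w a) * u a) = (\<Sum>a<N. (\<Sum>b<N. u a * J $$ (a, b) * u b - u a * J $$ (a, b) * v b))"
      by (intro sum.cong refl) (simp add: cw y_def sum_distrib_left algebra_simps)
    thus ?thesis using alt[of u] iso by (simp add: sum_subtractf)
  qed
  \<comment> \<open>If \<open>z = 0\<close>, then |y|^2 = 2 Re z = 0, so u = v and the identity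
    matrix serves; otherwise division by z is legitimate.\<close>
  show ?thesis
  proof (cases "z = 0")
    case True
    hence "(\<Sum>a<N. y a * cnj (y a)) = 0" using Yz Y_def by simp
    hence "of_real (\<Sum>a<N. (cmod (y a))\<^sup>2) = (0 :: complex)" by (simp only: of_real_sum complex_norm_square)
    hence "(\<Sum>a<N. (cmod (y a))\<^sup>2) = 0" using of_real_eq_0_iff by blast
    hence y0: "\<forall>a<N. y a = 0" by (simp add: sum_nonneg_eq_0_iff)
    have "1\<^sub>m N \<in> USp N J"
    proof -
      have "unitary_mat (1\<^sub>m N)"
        by (rule unitary_matI[of _ N])
           (auto simp: of_bool_def if_distrib[of "\<lambda>x. x * _"] cong: if_cong)
      thus ?thesis using Jc by (auto simp: USp_def)
    qed
    moreover have "(\<Sum>b<N. 1\<^sub>m N $$ (a, b) * u b) = v a" if "a < N" for a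
      using that y0 by (auto simp: y_def if_distrib[of "\<lambda>x. x * _"] cong: if_cong)
    ultimately show ?thesis by blast
  next
    case False
    have pq: "p + q = Y * p * q" and cp: "cnj p = q" and cq: "cnj q = p" 
      using False by (auto simp: p_def q_def Yz field_simps)
    define g where "g = Matrix.mat N N (\<lambda>(a, b). of_bool (a = b) - p * (y a * cnj (y b)) - q * (w a * cnj (w b)))"
    have gc: "g \<in> carrier_mat N N" by (simp add: g_def)
    have gi: "g $$ (a, b) = of_bool (a = b) - p * (y a * cnj (y b)) - q * (w a * cnj (w b))" if "a < N" "b < N" for a b
      using that by (simp add: g_def)
    have gmul: "(\<Sum>c<N. g $$ (a, c) * f c) = f a - p * y a * (\<Sum>c<N. cnj (y c) * f c) - q * w a * (\<Sum>c<N. cnj (w c) * f c)"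
      if "a < N" for a f
    proof -
      have "(\<Sum>c<N. g $$ (a, c) * f c) = (\<Sum>c<N. (if a = c then f c else 0) - p * y a * (cnj (y c) * f c) - q * w a * (cnj (w c) * f c))"
        using that by (intro sum.cong refl) (auto simp: gi algebra_simps)
      also have "\<dots> = f a - p * y a * (\<Sum>c<N. cnj (y c) * f c) - q * w a * (\<Sum>c<N. cnj (w c) * f c)"
        using that by (simp add: sum_subtractf sum_distrib_left)
      finally show ?thesis .
    qed
    have rows: "(\<Sum>c<N. g $$ (a, c) * cnj (g $$ (b, c))) = of_bool (a = b)" if ab: "a < N" "b < N" for a b
    proof -
      have s: "(\<Sum>c<N. cnj (f c) * cnj (g $$ (b, c))) =
          cnj (f b - p * y b * (\<Sum>c<N. cnj (y c) * f c) - q * w b * (\<Sum>c<N. cnj (w c) * f c))" for f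
        using arg_cong[OF gmul[OF ab(2), of f], where f=cnj] by (simp add: mult.commute)
      have 1: "(\<Sum>c<N. cnj (y c) * cnj (g $$ (b, c))) = cnj (y b) - q * cnj (y b) * Y"
        using s[of y] yw Y_def cp by (simp add: mult.commute)
      have 2: "(\<Sum>c<N. cnj (w c) * cnj (g $$ (b, c))) = cnj (w b) - p * cnj (w b) * Y"
        using s[of w] wy ww Y_def cq by (simp add: mult.commute)
      have "(\<Sum>c<N. g $$ (a, c) * cnj (g $$ (b, c))) = of_bool (a = b)
          - (y a * cnj (y b)) * (q + p - Y * p * q) - (w a * cnj (w b)) * (q + p - Y * p * q)"
        unfolding gmul[OF ab(1)] 1 2 gi[OF ab(2,1)] by (simp add: cp cq algebra_simps of_bool_def)
      thus ?thesis using pq by (simp add: add.commute)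
    qed
    have un: "unitary_mat g" by (rule unitary_matI[OF gc rows])
    \<comment> \<open>This is g J = J cnj(g). Conjugation exchanges \<open>p\<close> and
      \<open>q\<close>, while J maps cnj(y) to w and cnj(w) to -y, so the two rank-one terms trade
      places; this forces the second coefficient to be the conjugate of the first. Together with
      unitarity it gives g J g^T = J.\<close>
    have comm: "(\<Sum>c<N. g $$ (a, c) * J $$ (c, d)) = (\<Sum>c<N. J $$ (a, c) * cnj (g $$ (c, d)))"
      if ad: "a < N" "d < N" for a d
    proof -
      have 1: "(\<Sum>c<N. cnj (y c) * J $$ (c, d)) = - w d"
        unfolding w_def sum_negf[symmetric]
        by (intro sum.cong refl) (simp add: Jf(1)[OF ad(2)])
      have "(\<Sum>c<N. cnj (w c) * J $$ (c, d)) = (\<Sum>c<N. - (J $$ (d, c) * cnj (w c)))"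
        by (intro sum.cong refl) (simp add: Jf(1)[OF ad(2)])
      hence 2: "(\<Sum>c<N. cnj (w c) * J $$ (c, d)) = y d"
        using Jw[OF ad(2)] by (simp add: sum_negf)
      have "(\<Sum>c<N. J $$ (a, c) * cnj (g $$ (c, d))) =
         (\<Sum>c<N. (if c = d then J $$ (a, c) else 0) - q * y d * (J $$ (a, c) * cnj (y c)) - p * w d * (J $$ (a, c) * cnj (w c)))"
        using ad by (intro sum.cong refl) (auto simp: gi cp cq algebra_simps)
      also have "\<dots> = J $$ (a, d) - q * y d * w a - p * w d * (- y a)"
        unfolding sum_subtractf sum_distrib_left[symmetric] Jw[OF ad(1)] w_def[symmetric] using ad by simp
      finally show ?thesis unfolding gmul[OF ad(1)] 1 2 by (simp add: algebra_simps)
    qed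
    have "g * J * transpose_mat g = J"
    proof (rule eq_matI)
      fix i j assume "i < dim_row J" "j < dim_col J"
      hence ij: "i < N" "j < N" using Jc by auto
      have "(g * J * transpose_mat g) $$ (i, j) = (\<Sum>d<N. (\<Sum>c<N. g $$ (i, c) * J $$ (c, d)) * g $$ (j, d))"
        unfolding mult_mat_index_sum[OF mult_carrier_mat[OF gc Jc] iffD2[OF transpose_carrier_mat gc] ij]
        using gc ij by (intro sum.cong refl) (simp add: mult_mat_index_sum[OF gc Jc])
      also have "\<dots> = (\<Sum>d<N. \<Sum>c<N. J $$ (i, c) * (g $$ (j, d) * cnj (g $$ (c, d))))"
        using ij by (intro sum.cong refl, subst comm) (auto simp: sum_distrib_left mult_ac)
      also have "\<dots> = (\<Sum>c<N. J $$ (i, c) * (\<Sum>d<N. g $$ (j, d) * cnj (g $$ (c, d))))"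
        by (subst sum.swap) (simp add: sum_distrib_left)
      also have "\<dots> = (\<Sum>c<N. J $$ (i, c) * of_bool (j = c))"
        using ij rows by (intro sum.cong) auto
      also have "\<dots> = J $$ (i, j)" using ij by (simp add: of_bool_def if_distrib[of "\<lambda>x. _ * x"] cong: if_cong)
      finally show "(g * J * transpose_mat g) $$ (i, j) = J $$ (i, j)" .
    qed (use gc Jc in auto)
    hence "g \<in> USp N J" using gc un by (simp add: USp_def)
    moreover have "(\<Sum>b<N. g $$ (a, b) * u b) = v a" if "a < N" for a
    proof -
      have "(\<Sum>b<N. g $$ (a, b) * u b) = u a - p * y a * z"
        unfolding gmul[OF that] wu z_def by simp
      thus ?thesis using False by (simp add: p_def y_def)
    qed
    ultimately show ?thesis by blast
  qed
qed

text \<open>The cross product of the coefficient vectors is a solution. If it vanishes, (a 0, a 1)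
  and (b 0, b 1) are proportional, and a vector with last entry 0 orthogonal to both does the job.
  Entries from 3 on are 0, so the solution is also a vector in every dimension from 3 on.\<close>

lemma two_linear_equations:
  fixes a b :: "nat \<Rightarrow> complex"
  shows "\<exists>x. (\<exists>i<3. x i \<noteq> 0) \<and> (\<forall>i\<ge>3. x i = 0) \<and>
    (\<Sum>i<3. a i * x i) = 0 \<and> (\<Sum>i<3. b i * x i) = 0"
proof -
  define V where "V x y z = (\<lambda>i::nat. if i = 0 then x else if i = 1 then y else if i = 2 then z else 0)"
    for x y z :: complex
  have S: "(\<Sum>i<3. f i * V x y z i) = f 0 * x + f 1 * y + f 2 * z" for f x y z
    by (simp add: numeral_3_eq_3 V_def numeral_2_eq_2)
  have N: "(\<exists>i<3. V x y z i \<noteq> 0) \<longleftrightarrow> x \<noteq> 0 \<or> y \<noteq> 0 \<or> z \<noteq> 0" for x y z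
    by (simp add: numeral_3_eq_3 numeral_2_eq_2 V_def less_Suc_eq conj_disj_distribR ex_disj_distrib)
  have Z: "\<forall>i\<ge>3. V x y z i = 0" for x y z by (simp add: V_def)
  have "\<exists>x y z. (x \<noteq> 0 \<or> y \<noteq> 0 \<or> z \<noteq> 0) \<and> a 0 * x + a 1 * y + a 2 * z = 0 \<and> b 0 * x + b 1 * y + b 2 * z = 0"
  proof -
    consider "a 1 * b 2 - a 2 * b 1 \<noteq> 0 \<or> a 2 * b 0 - a 0 * b 2 \<noteq> 0 \<or> a 0 * b 1 - a 1 * b 0 \<noteq> 0"
      | "a 0 * b 1 = a 1 * b 0" "a 0 \<noteq> 0 \<or> a 1 \<noteq> 0"
      | "a 0 = 0" "a 1 = 0" "b 0 \<noteq> 0 \<or> b 1 \<noteq> 0"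
      | "a 0 = 0" "a 1 = 0" "b 0 = 0" "b 1 = 0" by auto
    thus ?thesis
    proof cases
      case 1
      thus ?thesis
        by (intro exI[of _ "a 1 * b 2 - a 2 * b 1"] exI[of _ "a 2 * b 0 - a 0 * b 2"]
            exI[of _ "a 0 * b 1 - a 1 * b 0"]) (simp add: algebra_simps)
    next
      case 2
      thus ?thesis by (intro exI[of _ "a 1"] exI[of _ "- a 0"] exI[of _ 0]) (auto simp: algebra_simps)
    next
      case 3
      thus ?thesis by (intro exI[of _ "b 1"] exI[of _ "- b 0"] exI[of _ 0]) (auto simp: algebra_simps)
    next
      case 4
      thus ?thesis by (intro exI[of _ 1] exI[of _ 0] exI[of _ 0]) auto
    qed
  qed
  then obtain x y z where "x \<noteq> 0 \<or> y \<noteq> 0 \<or> z \<noteq> 0"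
      "a 0 * x + a 1 * y + a 2 * z = 0" "b 0 * x + b 1 * y + b 2 * z = 0" by blast
  thus ?thesis by (intro exI[of _ "V x y z"]) (simp add: S N Z)
qed

text \<open>Two reflections suffice: pass through a vector \<open>w\<close> with \<open>u\<^sup>T J w = w\<^sup>T J v = 0\<close>, which exists
  because two linear equations in \<open>N \<ge> 3\<close> unknowns have a nonzero solution.\<close>

lemma USp_invariant_imp_norm_invariant:
  assumes J: "symplectic_form N J" and N: "3 \<le> N"
    and F: "\<And>g u v. g \<in> USp N J \<Longrightarrow> (\<And>a. a < N \<Longrightarrow> v a = (\<Sum>b<N. g $$ (a, b) * u b)) \<Longrightarrow> F u = F v"
    and norm: "(\<Sum>a<N. (cmod (u a))\<^sup>2) = (\<Sum>a<N. (cmod (v a))\<^sup>2)"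
  shows "F u = (F v :: real)"
proof -
  have step: "F x = F y" if "(\<Sum>a<N. (cmod (x a))\<^sup>2) = (\<Sum>a<N. (cmod (y a))\<^sup>2)"
    and "(\<Sum>a<N. \<Sum>b<N. x a * J $$ (a, b) * y b) = 0" for x y
  proof -
    have "of_real (\<Sum>a<N. (cmod (x a))\<^sup>2) = (of_real (\<Sum>a<N. (cmod (y a))\<^sup>2) :: complex)"
      using that(1) by simp
    hence "(\<Sum>a<N. x a * cnj (x a)) = (\<Sum>a<N. y a * cnj (y a))"
      by (simp only: of_real_sum complex_norm_square)
    from symplectic_reflection[OF J this that(2)] show ?thesis using F by metis
  qed
  \<comment> \<open>The two conditions on the intermediate vector are linear in it, with
    coefficients \<open>a\<close> and \<open>b\<close>. They survive rescaling, so the solution can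
    be given the norm of \<open>u\<close> afterwards.\<close>
  define a b where "a i = (\<Sum>j<N. u j * J $$ (j, i))" and "b i = (\<Sum>j<N. J $$ (i, j) * v j)" for i
  obtain x where x: "\<exists>i<3. x i \<noteq> 0" "\<forall>i\<ge>3. x i = 0" "(\<Sum>i<3. a i * x i) = 0" "(\<Sum>i<3. b i * x i) = 0"
    using two_linear_equations[of a b] by blast
  have ext: "(\<Sum>i<N. f i * x i) = (\<Sum>i<3. f i * x i)" for f
    using N x(2) by (intro sum.mono_neutral_right) auto
  define s where "s = (\<Sum>a<N. (cmod (u a))\<^sup>2)"
  define S where "S = (\<Sum>a<N. (cmod (x a))\<^sup>2)"
  have S: "S > 0"
  proof -
    obtain i where i: "i < 3" "x i \<noteq> 0" using x(1) by blast
    have "0 < (cmod (x i))\<^sup>2" using i by simp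
    also have "\<dots> \<le> S" unfolding S_def using i N by (intro member_le_sum) auto
    finally show ?thesis .
  qed
  have s: "s \<ge> 0" by (simp add: s_def sum_nonneg)
  define r where "r = complex_of_real (sqrt (s / S))"
  define w where "w i = r * x i" for i
  have w: "(\<Sum>a<N. (cmod (w a))\<^sup>2) = s"
  proof -
    have "(\<Sum>a<N. (cmod (w a))\<^sup>2) = (\<Sum>a<N. (s / S) * (cmod (x a))\<^sup>2)"
      using s S by (intro sum.cong refl) (simp add: w_def r_def norm_mult power_mult_distrib)
    also have "\<dots> = s / S * S" unfolding S_def by (simp only: sum_distrib_left)
    also have "\<dots> = s" using S by simp
    finally show ?thesis .
  qed
  have "F u = F w"
  proof (rule step)
    show "(\<Sum>a<N. (cmod (u a))\<^sup>2) = (\<Sum>a<N. (cmod (w a))\<^sup>2)" using w s_def by simp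
    have "(\<Sum>a<N. \<Sum>b<N. u a * J $$ (a, b) * w b) = (\<Sum>b<N. r * (a b * x b))"
      unfolding a_def w_def by (subst sum.swap) (simp add: sum_distrib_left sum_distrib_right mult_ac)
    also have "\<dots> = 0" using ext[of a] x(3) by (simp add: sum_distrib_left[symmetric])
    finally show "(\<Sum>a<N. \<Sum>b<N. u a * J $$ (a, b) * w b) = 0" .
  qed
  also have "F w = F v"
  proof (rule step)
    show "(\<Sum>a<N. (cmod (w a))\<^sup>2) = (\<Sum>a<N. (cmod (v a))\<^sup>2)" using w s_def norm by simp
    have "(\<Sum>a<N. \<Sum>c<N. w a * J $$ (a, c) * v c) = (\<Sum>a<N. r * (b a * x a))"
      unfolding b_def w_def by (simp add: sum_distrib_left sum_distrib_right mult_ac)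
    also have "\<dots> = 0" using ext[of b] x(4) by (simp add: sum_distrib_left[symmetric])
    finally show "(\<Sum>a<N. \<Sum>c<N. w a * J $$ (a, c) * v c) = 0" .
  qed
  finally show ?thesis .
qed

text \<open>A function of the norm alone can be evaluated at a multiple of the first basis vector,
  where homogeneity is explicit and the constant can be read off.\<close>

lemma norm_invariant_homogeneous:
  fixes F :: "(nat \<Rightarrow> complex) \<Rightarrow> real"
  assumes N: "0 < N"
    and F: "\<And>u v. (\<Sum>a<N. (cmod (u a))\<^sup>2) = (\<Sum>a<N. (cmod (v a))\<^sup>2) \<Longrightarrow> F u = F v"
    and hom: "\<And>r::real. F (\<lambda>a. if a = 0 then complex_of_real r else 0) = r ^ (2 * k) * c"
  shows "F x = c * (\<Sum>a<N. (cmod (x a))\<^sup>2) ^ k"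
proof -
  define s where "s = (\<Sum>a<N. (cmod (x a))\<^sup>2)"
  have s: "s \<ge> 0" by (simp add: s_def sum_nonneg)
  have "F x = F (\<lambda>a. if a = 0 then complex_of_real (sqrt s) else 0)"
  proof (rule F)
    have "(\<Sum>a<N. (cmod (if a = 0 then complex_of_real (sqrt s) else 0))\<^sup>2) = (\<Sum>a<N. if a = 0 then s else 0)"
      using s by (intro sum.cong) auto
    thus "(\<Sum>a<N. (cmod (x a))\<^sup>2) = (\<Sum>a<N. (cmod (if a = 0 then complex_of_real (sqrt s) else 0))\<^sup>2)"
      using N by (simp add: s_def)
  qed
  also have "\<dots> = c * s ^ k" unfolding hom using s by (simp add: power_mult)
  finally show ?thesis by (simp add: s_def)
qed

section \<open>Haar measure on the unitary symplectic group\<close>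

lemma measurable_mat_entry:
  assumes "i < N" "j < N"
  shows "(\<lambda>U. U $$ (i, j)) \<in> borel_measurable (mat_space N)"
proof -
  have "(\<lambda>A. \<lambda>ij\<in>{..<N} \<times> {..<N}. A $$ ij) \<in> mat_space N \<rightarrow>\<^sub>M
      (\<Pi>\<^sub>M ij \<in> {..<N} \<times> {..<N}. (borel :: complex measure))"
    unfolding mat_space_def by (rule measurable_vimage_algebra1) (auto simp: space_PiM)
  moreover have "(\<lambda>f. f (i, j)) \<in> borel_measurable (\<Pi>\<^sub>M ij \<in> {..<N} \<times> {..<N}. (borel :: complex measure))"
    using assms by (intro measurable_component_singleton) auto
  ultimately have "(\<lambda>A. (\<lambda>ij\<in>{..<N} \<times> {..<N}. A $$ ij) (i, j)) \<in> borel_measurable (mat_space N)"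
    by (rule measurable_compose)
  thus ?thesis using assms by simp
qed

lemma measurable_into_mat_space:
  assumes "\<And>x. x \<in> space M \<Longrightarrow> f x \<in> carrier_mat N N"
    and "\<And>i j. i < N \<Longrightarrow> j < N \<Longrightarrow> (\<lambda>x. f x $$ (i, j)) \<in> borel_measurable M"
  shows "f \<in> M \<rightarrow>\<^sub>M mat_space N"
  unfolding mat_space_def
proof (rule measurable_vimage_algebra2)
  show "(\<lambda>x. \<lambda>ij\<in>{..<N} \<times> {..<N}. f x $$ ij) \<in> M \<rightarrow>\<^sub>M (\<Pi>\<^sub>M ij \<in> {..<N} \<times> {..<N}. borel)"
    using assms(2) by (intro measurable_restrict) auto
qed (use assms(1) in auto)

lemma USp_mult:
  assumes "g \<in> USp N J" "h \<in> USp N J" and J: "J \<in> carrier_mat N N"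
  shows "g * h \<in> USp N J"
proof -
  have g: "g \<in> carrier_mat N N" "unitary_mat g" "g * J * transpose_mat g = J"
    and h: "h \<in> carrier_mat N N" "unitary_mat h" "h * J * transpose_mat h = J"
    using assms by (auto simp: USp_def)
  have "unitary_mat (g * h)"
  proof (rule unitary_matI)
    show "g * h \<in> carrier_mat N N" using g h by simp
    fix a b assume ab: "a < N" "b < N"
    have "(\<Sum>c<N. (g * h) $$ (a, c) * cnj ((g * h) $$ (b, c))) =
        (\<Sum>c<N. \<Sum>d<N. \<Sum>e<N. g $$ (a, d) * cnj (g $$ (b, e)) * (h $$ (d, c) * cnj (h $$ (e, c))))"
      using ab by (intro sum.cong refl) (simp add: mult_mat_index_sum[OF g(1) h(1)] sum_product mult_ac
        del: index_mult_mat)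
    also have "\<dots> = (\<Sum>d<N. \<Sum>c<N. \<Sum>e<N. g $$ (a, d) * cnj (g $$ (b, e)) * (h $$ (d, c) * cnj (h $$ (e, c))))"
      by (rule sum.swap)
    also have "\<dots> = (\<Sum>d<N. \<Sum>e<N. \<Sum>c<N. g $$ (a, d) * cnj (g $$ (b, e)) * (h $$ (d, c) * cnj (h $$ (e, c))))"
      by (intro sum.cong refl sum.swap)
    also have "\<dots> = (\<Sum>d<N. \<Sum>e<N. g $$ (a, d) * cnj (g $$ (b, e)) * of_bool (d = e))"
      by (intro sum.cong refl) (simp add: sum_distrib_left[symmetric] unitary_mat_rows[OF h(2,1)])
    also have "\<dots> = (\<Sum>d<N. g $$ (a, d) * cnj (g $$ (b, d)))"
      by (intro sum.cong refl) (simp add: of_bool_def if_distrib[of "\<lambda>x. _ * x"] cong: if_cong)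
    finally show "(\<Sum>c<N. (g * h) $$ (a, c) * cnj ((g * h) $$ (b, c))) = of_bool (a = b)"
      using unitary_mat_rows[OF g(2,1) ab] by simp
  qed
  moreover have "g * h * J * transpose_mat (g * h) = g * (h * J * transpose_mat h) * transpose_mat g"
    using g(1) h(1) J by (simp add: transpose_mult[of _ N N _ N] assoc_mult_mat[of _ N N _ N _ N])
  ultimately show ?thesis using g h by (simp add: USp_def)
qed

lemma is_haarD:
  assumes "is_haar N G \<mu>"
  shows "prob_space \<mu>" "space \<mu> = G" "sets \<mu> = sets (restrict_space (mat_space N) G)"
    "\<And>g. g \<in> G \<Longrightarrow> distr \<mu> \<mu> (\<lambda>U. g * U) = \<mu>" "\<And>g. g \<in> G \<Longrightarrow> distr \<mu> \<mu> (\<lambda>U. U * g) = \<mu>"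
  using assms by (auto simp: is_haar_def)

lemma haar_measurable_entry:
  assumes "is_haar N (USp N J) \<mu>" "i < N" "j < N"
  shows "(\<lambda>U. U $$ (i, j)) \<in> borel_measurable \<mu>"
  unfolding measurable_cong_sets[OF is_haarD(3)[OF assms(1)] refl]
  by (intro measurable_restrict_space1 measurable_mat_entry assms)

lemma haar_measurable_mult:
  assumes h: "is_haar N (USp N J) \<mu>" and g: "g \<in> USp N J" and J: "J \<in> carrier_mat N N"
  shows "(\<lambda>U. g * U) \<in> \<mu> \<rightarrow>\<^sub>M \<mu>" "(\<lambda>U. U * g) \<in> \<mu> \<rightarrow>\<^sub>M \<mu>"
proof -
  have gc: "g \<in> carrier_mat N N" using g by (simp add: USp_def)
  have sp: "space \<mu> = USp N J" by (rule is_haarD(2)[OF h])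
  have Uc: "U \<in> carrier_mat N N" if "U \<in> space \<mu>" for U using that sp by (simp add: USp_def)
  note [measurable] = haar_measurable_entry[OF h]
  have "(\<lambda>U. g * U) \<in> \<mu> \<rightarrow>\<^sub>M restrict_space (mat_space N) (USp N J)"
  proof (intro measurable_restrict_space2 measurable_into_mat_space)
    fix i j assume ij: "i < N" "j < N"
    have "(\<lambda>U. \<Sum>c<N. g $$ (i, c) * U $$ (c, j)) \<in> borel_measurable \<mu>" using ij by measurable
    thus "(\<lambda>U. (g * U) $$ (i, j)) \<in> borel_measurable \<mu>"
      by (rule measurable_cong[THEN iffD1, rotated]) (simp add: mult_mat_index_sum[OF gc Uc ij] del: index_mult_mat)
  qed (use Uc gc USp_mult[OF g _ J] sp in auto)
  thus "(\<lambda>U. g * U) \<in> \<mu> \<rightarrow>\<^sub>M \<mu>"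
    by (simp add: measurable_cong_sets[OF refl is_haarD(3)[OF h]])
  have "(\<lambda>U. U * g) \<in> \<mu> \<rightarrow>\<^sub>M restrict_space (mat_space N) (USp N J)"
  proof (intro measurable_restrict_space2 measurable_into_mat_space)
    fix i j assume ij: "i < N" "j < N"
    have "(\<lambda>U. \<Sum>c<N. U $$ (i, c) * g $$ (c, j)) \<in> borel_measurable \<mu>" using ij by measurable
    thus "(\<lambda>U. (U * g) $$ (i, j)) \<in> borel_measurable \<mu>"
      by (rule measurable_cong[THEN iffD1, rotated]) (simp add: mult_mat_index_sum[OF Uc gc ij] del: index_mult_mat)
  qed (use Uc gc USp_mult[OF _ g J] sp in auto)
  thus "(\<lambda>U. U * g) \<in> \<mu> \<rightarrow>\<^sub>M \<mu>"
    by (simp add: measurable_cong_sets[OF refl is_haarD(3)[OF h]])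
qed

text \<open>Right invariance moves \<open>g\<close> from \<open>U\<close> onto the vector paired
  with its row, so the integral is constant on orbits, hence on spheres. At the first basis vector
  it is the moment of the entry (0, 0).\<close>

lemma haar_row_moment:
  assumes h: "is_haar N (USp N J) \<mu>" and J: "symplectic_form N J" and N: "3 \<le> N"
  shows "(\<integral>U. (cmod (\<Sum>b<N. U $$ (0, b) * x b)) ^ (2 * k) \<partial>\<mu>) =
    zero_amplitude_moment \<mu> k * (\<Sum>b<N. (cmod (x b))\<^sup>2) ^ k"
proof (rule norm_invariant_homogeneous[where F = "\<lambda>x. \<integral>U. (cmod (\<Sum>b<N. U $$ (0, b) * x b)) ^ (2 * k) \<partial>\<mu>"])
  have Jc: "J \<in> carrier_mat N N" using J by (simp add: symplectic_form_def)
  have sp: "space \<mu> = USp N J" by (rule is_haarD(2)[OF h])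
  note [measurable] = haar_measurable_entry[OF h]
  fix u v :: "nat \<Rightarrow> complex" assume norm: "(\<Sum>a<N. (cmod (u a))\<^sup>2) = (\<Sum>a<N. (cmod (v a))\<^sup>2)"
  show "(\<integral>U. (cmod (\<Sum>b<N. U $$ (0, b) * u b)) ^ (2 * k) \<partial>\<mu>) =
     (\<integral>U. (cmod (\<Sum>b<N. U $$ (0, b) * v b)) ^ (2 * k) \<partial>\<mu>)"
  proof (rule USp_invariant_imp_norm_invariant[OF J N _ norm])
    fix g and u v :: "nat \<Rightarrow> complex"
    assume g: "g \<in> USp N J" and v: "\<And>a. a < N \<Longrightarrow> v a = (\<Sum>b<N. g $$ (a, b) * u b)"
    have gc: "g \<in> carrier_mat N N" using g by (simp add: USp_def)
    have "(\<integral>U. (cmod (\<Sum>b<N. U $$ (0, b) * u b)) ^ (2 * k) \<partial>\<mu>) =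
       (\<integral>U. (cmod (\<Sum>b<N. U $$ (0, b) * u b)) ^ (2 * k) \<partial>distr \<mu> \<mu> (\<lambda>U. U * g))"
      using is_haarD(5)[OF h g] by simp
    also have "\<dots> = (\<integral>U. (cmod (\<Sum>b<N. (U * g) $$ (0, b) * u b)) ^ (2 * k) \<partial>\<mu>)"
      using N by (intro integral_distr haar_measurable_mult[OF h g Jc]) measurable
    also have "\<dots> = (\<integral>U. (cmod (\<Sum>b<N. U $$ (0, b) * v b)) ^ (2 * k) \<partial>\<mu>)"
    proof (intro Bochner_Integration.integral_cong refl arg_cong[where f = "\<lambda>z. cmod z ^ (2 * k)"])
      fix U assume "U \<in> space \<mu>"
      hence U: "U \<in> carrier_mat N N" using sp by (simp add: USp_def)
      have "(\<Sum>b<N. (U * g) $$ (0, b) * u b) = (\<Sum>b<N. \<Sum>c<N. U $$ (0, c) * (g $$ (c, b) * u b))"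
        using N by (intro sum.cong refl)
          (simp add: mult_mat_index_sum[OF U gc] sum_distrib_right mult.assoc del: index_mult_mat)
      also have "\<dots> = (\<Sum>b<N. U $$ (0, b) * v b)"
        by (subst sum.swap) (simp add: sum_distrib_left v)
      finally show "(\<Sum>b<N. (U * g) $$ (0, b) * u b) = (\<Sum>b<N. U $$ (0, b) * v b)" .
    qed
    finally show "(\<integral>U. (cmod (\<Sum>b<N. U $$ (0, b) * u b)) ^ (2 * k) \<partial>\<mu>) =
     (\<integral>U. (cmod (\<Sum>b<N. U $$ (0, b) * v b)) ^ (2 * k) \<partial>\<mu>)" .
  qed
next
  fix r :: real
  have "(\<Sum>b<N. U $$ (0, b) * (if b = 0 then complex_of_real r else 0)) = U $$ (0, 0) * complex_of_real r" for U
    using N by (simp add: if_distrib[of "\<lambda>x. _ * x"] cong: if_cong)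
  thus "(\<integral>U. (cmod (\<Sum>b<N. U $$ (0, b) * (if b = 0 then complex_of_real r else 0))) ^ (2 * k) \<partial>\<mu>) =
      r ^ (2 * k) * zero_amplitude_moment \<mu> k"
    by (simp add: norm_mult power_mult_distrib zero_amplitude_moment_def power_even_abs mult.commute)
qed (use N in auto)

lemma haar_column_moment:
  assumes h: "is_haar N (USp N J) \<mu>" and J: "symplectic_form N J" and N: "3 \<le> N"
  shows "(\<integral>U. (cmod (\<Sum>b<N. U $$ (b, 0) * x b)) ^ (2 * k) \<partial>\<mu>) =
    zero_amplitude_moment \<mu> k * (\<Sum>b<N. (cmod (x b))\<^sup>2) ^ k"
proof -
  have Jc: "J \<in> carrier_mat N N" using J by (simp add: symplectic_form_def)
  have sp: "space \<mu> = USp N J" by (rule is_haarD(2)[OF h])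
  note [measurable] = haar_measurable_entry[OF h]
  \<comment> \<open>The conjugate makes this the inner product of column 0 with \<open>x\<close>,
    which is unchanged when both are multiplied by the unitary \<open>g\<close>. Left invariance
    then gives F (g x) = F x; the bilinear pairing would produce the transpose of \<open>g\<close>
    instead.\<close>
  define F where "F x = (\<integral>U. (cmod (\<Sum>b<N. U $$ (b, 0) * cnj (x b))) ^ (2 * k) \<partial>\<mu>)" for x
  have inv: "F u = F v" if norm: "(\<Sum>a<N. (cmod (u a))\<^sup>2) = (\<Sum>a<N. (cmod (v a))\<^sup>2)" for u v
  proof (rule USp_invariant_imp_norm_invariant[OF J N _ norm])
    fix g and u v :: "nat \<Rightarrow> complex"
    assume g: "g \<in> USp N J" and v: "\<And>a. a < N \<Longrightarrow> v a = (\<Sum>b<N. g $$ (a, b) * u b)"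
    have gc: "g \<in> carrier_mat N N" and gu: "unitary_mat g" using g by (auto simp: USp_def)
    have "F v = (\<integral>U. (cmod (\<Sum>b<N. U $$ (b, 0) * cnj (v b))) ^ (2 * k) \<partial>distr \<mu> \<mu> (\<lambda>U. g * U))"
      using is_haarD(4)[OF h g] by (simp add: F_def)
    also have "\<dots> = (\<integral>U. (cmod (\<Sum>b<N. (g * U) $$ (b, 0) * cnj (v b))) ^ (2 * k) \<partial>\<mu>)"
      using N by (intro integral_distr haar_measurable_mult[OF h g Jc]) measurable
    also have "\<dots> = F u" unfolding F_def
    proof (intro Bochner_Integration.integral_cong refl arg_cong[where f = "\<lambda>z. cmod z ^ (2 * k)"])
      fix U assume "U \<in> space \<mu>"
      hence U: "U \<in> carrier_mat N N" using sp by (simp add: USp_def)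
      have "(\<Sum>a<N. (g * U) $$ (a, 0) * cnj (v a)) =
          (\<Sum>a<N. \<Sum>b<N. \<Sum>c<N. cnj (g $$ (a, b)) * g $$ (a, c) * (U $$ (c, 0) * cnj (u b)))"
        using N by (intro sum.cong refl)
          (simp add: mult_mat_index_sum[OF gc U] v sum_product mult_ac del: index_mult_mat)
      also have "\<dots> = (\<Sum>b<N. \<Sum>a<N. \<Sum>c<N. cnj (g $$ (a, b)) * g $$ (a, c) * (U $$ (c, 0) * cnj (u b)))"
        by (rule sum.swap)
      also have "\<dots> = (\<Sum>b<N. \<Sum>c<N. \<Sum>a<N. cnj (g $$ (a, b)) * g $$ (a, c) * (U $$ (c, 0) * cnj (u b)))"
        by (intro sum.cong refl sum.swap)
      also have "\<dots> = (\<Sum>b<N. \<Sum>c<N. of_bool (b = c) * (U $$ (c, 0) * cnj (u b)))"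
        by (intro sum.cong refl) (simp add: sum_distrib_right[symmetric] unitary_mat_cols[OF gu gc])
      also have "\<dots> = (\<Sum>b<N. U $$ (b, 0) * cnj (u b))"
        by (intro sum.cong refl) (simp add: of_bool_def if_distrib[of "\<lambda>x. x * _"] cong: if_cong)
      finally show "(\<Sum>b<N. (g * U) $$ (b, 0) * cnj (v b)) = (\<Sum>b<N. U $$ (b, 0) * cnj (u b))" .
    qed
    finally show "F u = F v" ..
  qed
  have "F (\<lambda>b. cnj (x b)) = zero_amplitude_moment \<mu> k * (\<Sum>b<N. (cmod (cnj (x b)))\<^sup>2) ^ k"
  proof (rule norm_invariant_homogeneous[OF _ inv])
    fix r :: real
    have "(\<Sum>b<N. U $$ (b, 0) * cnj (if b = 0 then complex_of_real r else 0)) = U $$ (0, 0) * complex_of_real r" for U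
      using N by (simp add: if_distrib[of "\<lambda>x. _ * x"] if_distrib[of cnj] cong: if_cong)
    thus "F (\<lambda>a. if a = 0 then complex_of_real r else 0) = r ^ (2 * k) * zero_amplitude_moment \<mu> k"
      by (simp add: F_def norm_mult power_mult_distrib zero_amplitude_moment_def power_even_abs mult.commute)
  qed (use N in auto)
  thus ?thesis by (simp add: F_def)
qed

section \<open>Norm moments of isotropic random vectors\<close>

text \<open>Second-order term of the multinomial expansion: either one quadratic factor or two
  linear ones. Truncated exponents are harmless, since their prefactors vanish whenever truncation
  occurs.\<close>

lemma coeff_quadratic_power:
  fixes \<alpha> \<beta> \<gamma> :: real
  shows "coeff ([:\<alpha>, \<beta>, \<gamma>:] ^ p) 2 = of_nat p * \<alpha> ^ (p - 1) * \<gamma> + of_nat (p choose 2) * \<alpha> ^ (p - 2) * \<beta>\<^sup>2"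
proof -
  have m: "coeff ([:\<alpha>, \<beta>, \<gamma>:] * q) 0 = \<alpha> * coeff q 0"
    "coeff ([:\<alpha>, \<beta>, \<gamma>:] * q) (Suc 0) = \<alpha> * coeff q (Suc 0) + \<beta> * coeff q 0"
    "coeff ([:\<alpha>, \<beta>, \<gamma>:] * q) (Suc (Suc 0)) = \<alpha> * coeff q (Suc (Suc 0)) + \<beta> * coeff q (Suc 0) + \<gamma> * coeff q 0" for q
    by (simp_all add: mult_pCons_left)
  have 0: "coeff ([:\<alpha>, \<beta>, \<gamma>:] ^ p) 0 = \<alpha> ^ p" for p
    by (induction p) (simp_all only: power_Suc m, simp_all)
  have 1: "coeff ([:\<alpha>, \<beta>, \<gamma>:] ^ p) (Suc 0) = of_nat p * \<alpha> ^ (p - 1) * \<beta>" for p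
  proof (induction p)
    case (Suc p)
    show ?case unfolding power_Suc m 0 Suc by (cases p) (simp_all add: algebra_simps)
  qed simp
  have "coeff ([:\<alpha>, \<beta>, \<gamma>:] ^ p) (Suc (Suc 0)) =
      of_nat p * \<alpha> ^ (p - 1) * \<gamma> + of_nat (p choose 2) * \<alpha> ^ (p - 2) * \<beta>\<^sup>2"
  proof (induction p)
    case (Suc p)
    consider "p = 0" | "p = 1" | r where "p = Suc (Suc r)" by (metis One_nat_def not0_implies_Suc)
    thus ?case unfolding power_Suc m 0 1 Suc
      by cases (simp_all add: algebra_simps power2_eq_square numeral_2_eq_2)
  qed simp
  thus ?thesis by (simp add: numeral_2_eq_2)
qed

text \<open>All integrands below for a single superblock are built from entries of unitary matrices,
  which are bounded by 1. This class is closed under the operations used and consists of integrable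
  functions when the measure is finite and the values are real, so integrability follows from the
  shape of the term.\<close>

definition bounded_measurable :: "'a measure \<Rightarrow> ('a \<Rightarrow> 'b::{second_countable_topology,real_normed_algebra_1}) \<Rightarrow> bool" where
  "bounded_measurable M f \<longleftrightarrow> f \<in> borel_measurable M \<and> (\<exists>B. \<forall>x\<in>space M. norm (f x) \<le> B)"

lemma bounded_measurable_const: "bounded_measurable M (\<lambda>_. c)"
  by (auto simp: bounded_measurable_def)

lemma bounded_measurable_add:
  assumes "bounded_measurable M f" "bounded_measurable M g"
  shows "bounded_measurable M (\<lambda>x. f x + g x)"
proof -
  obtain A B where "\<forall>x\<in>space M. norm (f x) \<le> A" "\<forall>x\<in>space M. norm (g x) \<le> B"
    using assms by (auto simp: bounded_measurable_def)
  hence "\<forall>x\<in>space M. norm (f x + g x) \<le> A + B"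
    by (meson add_mono norm_triangle_le)
  thus ?thesis using assms by (auto simp: bounded_measurable_def)
qed

lemma bounded_measurable_mult:
  assumes "bounded_measurable M f" "bounded_measurable M g"
  shows "bounded_measurable M (\<lambda>x. f x * g x)"
proof -
  obtain A B where "\<forall>x\<in>space M. norm (f x) \<le> A" "\<forall>x\<in>space M. norm (g x) \<le> B"
    using assms by (auto simp: bounded_measurable_def)
  hence "\<forall>x\<in>space M. norm (f x * g x) \<le> A * B"
    by (meson norm_mult_ineq mult_mono norm_ge_zero order_trans)
  thus ?thesis using assms by (auto simp: bounded_measurable_def)
qed

lemma bounded_measurable_power:
  "bounded_measurable M f \<Longrightarrow> bounded_measurable M (\<lambda>x. f x ^ n)"
  by (induction n) (simp_all add: bounded_measurable_const bounded_measurable_mult)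

lemma bounded_measurable_sum:
  "(\<And>i. i \<in> I \<Longrightarrow> bounded_measurable M (f i)) \<Longrightarrow> bounded_measurable M (\<lambda>x. \<Sum>i\<in>I. f i x)"
  by (induction I rule: infinite_finite_induct)
     (simp_all add: bounded_measurable_const bounded_measurable_add)

lemma bounded_measurable_complex:
  fixes f :: "'a \<Rightarrow> complex"
  assumes "bounded_measurable M f"
  shows "bounded_measurable M (\<lambda>x. Re (f x))" "bounded_measurable M (\<lambda>x. cmod (f x))"
    "bounded_measurable M (\<lambda>x. cnj (f x))"
proof -
  obtain B where B: "\<forall>x\<in>space M. cmod (f x) \<le> B" and [measurable]: "f \<in> borel_measurable M"
    using assms by (auto simp: bounded_measurable_def)
  have "\<forall>x\<in>space M. \<bar>Re (f x)\<bar> \<le> B" using B abs_Re_le_cmod order_trans by blast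
  moreover have "(\<lambda>x. cnj (f x)) \<in> borel_measurable M"
    by (rule borel_measurable_continuous_on[OF continuous_on_cnj[OF continuous_on_id]]) measurable
  ultimately show "bounded_measurable M (\<lambda>x. Re (f x))" "bounded_measurable M (\<lambda>x. cmod (f x))"
    "bounded_measurable M (\<lambda>x. cnj (f x))"
    using B by (auto simp: bounded_measurable_def)
qed

lemma bounded_measurable_coeff_quadratic_power:
  fixes a b c :: "'a \<Rightarrow> real"
  assumes "bounded_measurable M a" "bounded_measurable M b" "bounded_measurable M c"
  shows "bounded_measurable M (\<lambda>x. coeff ([:a x, b x, c x:] ^ p) j)"
proof (induction p arbitrary: j)
  case 0
  show ?case by (simp add: bounded_measurable_const)
next
  case (Suc p)
  have "(\<lambda>x. coeff ([:a x, b x, c x:] ^ Suc p) j) = (\<lambda>x. a x * coeff ([:a x, b x, c x:] ^ p) j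
     + b x * (if j = 0 then 0 else coeff ([:a x, b x, c x:] ^ p) (j - 1))
     + c x * (if j < 2 then 0 else coeff ([:a x, b x, c x:] ^ p) (j - 2)))"
    by (cases j; cases "j - 1") (auto simp: mult_pCons_left fun_eq_iff)
  moreover have "bounded_measurable M (\<lambda>x. if j = 0 then 0 else coeff ([:a x, b x, c x:] ^ p) (j - 1))"
    "bounded_measurable M (\<lambda>x. if j < 2 then 0 else coeff ([:a x, b x, c x:] ^ p) (j - 2))"
    using Suc by (cases "j = 0"; cases "j < 2"; simp add: bounded_measurable_const)+
  ultimately show ?case using assms Suc
    by (auto intro!: bounded_measurable_add bounded_measurable_mult)
qed

lemma (in finite_measure) bounded_measurable_integrable:
  fixes f :: "'a \<Rightarrow> real"
  assumes "bounded_measurable M f"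
  shows "integrable M f"
proof -
  obtain B where "\<forall>x\<in>space M. norm (f x) \<le> B" using assms by (auto simp: bounded_measurable_def)
  thus ?thesis using assms
    by (intro integrable_const_bound[where B = B]) (auto simp: bounded_measurable_def)
qed

text \<open>Polynomials in \<open>h\<close> that agree at every real \<open>h\<close> have equal
  coefficients; the uniform degree bound makes the exchange of sum and integral finite. This
  replaces differentiation under the integral sign.\<close>

lemma integral_coeff_eq:
  fixes Q :: "'a \<Rightarrow> real poly"
  assumes int: "\<And>j. integrable M (\<lambda>x. coeff (Q x) j * R x)" and deg: "\<And>x. degree (Q x) \<le> n"
    and eq: "\<And>h. (\<integral>x. poly (Q x) h * R x \<partial>M) = poly q h"
  shows "(\<integral>x. coeff (Q x) j * R x \<partial>M) = coeff q j"
proof -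
  define X where "X = (\<Sum>j\<le>n. monom (\<integral>x. coeff (Q x) j * R x \<partial>M) j)"
  have "poly X h = poly q h" for h
  proof -
    have p: "poly (Q x) h = (\<Sum>j\<le>n. coeff (Q x) j * h ^ j)" for x
      unfolding poly_altdef using deg
      by (intro sum.mono_neutral_left) (auto simp: coeff_eq_0)
    have "poly q h = (\<integral>x. (\<Sum>j\<le>n. h ^ j * (coeff (Q x) j * R x)) \<partial>M)"
      unfolding eq[symmetric] p by (simp add: sum_distrib_right sum_distrib_left mult_ac)
    also have "\<dots> = (\<Sum>j\<le>n. h ^ j * (\<integral>x. coeff (Q x) j * R x \<partial>M))"
      using int by (subst Bochner_Integration.integral_sum) auto
    finally show ?thesis by (simp add: X_def poly_sum poly_monom mult.commute)
  qed
  hence "X = q" by (intro poly_eqI_degree_lead_coeff poly_ext) auto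
  moreover have "coeff X j = (\<integral>x. coeff (Q x) j * R x \<partial>M)"
  proof (cases "j \<le> n")
    case True
    thus ?thesis by (simp add: X_def coeff_sum)
  next
    case False
    hence "coeff (Q x) j = 0" for x using deg[of x] by (intro coeff_eq_0) auto
    thus ?thesis using False by (simp add: X_def coeff_sum)
  qed
  ultimately show ?thesis by simp
qed

lemma cmod_add_square: "(cmod (z + complex_of_real h * w))\<^sup>2 = (cmod z)\<^sup>2 + h * (2 * Re (cnj z * w)) + h\<^sup>2 * (cmod w)\<^sup>2"
  unfolding cmod_power2 by (simp add: power2_eq_square algebra_simps)

lemma Re_square_add_Re_ii_square: "(Re z)\<^sup>2 + (Re (z * \<i>))\<^sup>2 = (cmod z)\<^sup>2"
  by (simp add: cmod_power2)

text \<open>Compare the coefficients of \<open>h\<^sup>2\<close> on both sides of the hypothesis at \<open>t + h \<omega> e\<^sub>a\<close>, then sum over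
  \<open>\<omega> \<in> {1, \<i>}\<close> and over \<open>a\<close>; in effect both sides are hit with the Laplacian in \<open>t\<close>.\<close>

lemma (in finite_measure) isotropic_moment_step:
  fixes l :: "'a \<Rightarrow> nat \<Rightarrow> complex" and R :: "'a \<Rightarrow> real"
  assumes l: "\<And>a. a < D \<Longrightarrow> bounded_measurable M (\<lambda>x. l x a)" and R: "bounded_measurable M R"
    and iso: "\<And>t. (\<integral>x. (cmod (\<Sum>a<D. t a * l x a)) ^ (2 * Suc p) * R x \<partial>M) = c * (\<Sum>a<D. (cmod (t a))\<^sup>2) ^ Suc p"
  shows "(\<integral>x. (cmod (\<Sum>a<D. t a * l x a)) ^ (2 * p) * ((\<Sum>a<D. (cmod (l x a))\<^sup>2) * R x) \<partial>M) =
      c * ((real D + real p) / real (Suc p)) * (\<Sum>a<D. (cmod (t a))\<^sup>2) ^ p"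
proof -
  define T where "T x = (\<Sum>a<D. t a * l x a)" for x
  define n where "n = (\<Sum>a<D. (cmod (t a))\<^sup>2)"
  define A where "A x = (cmod (T x))\<^sup>2" for x
  let ?P = "Suc p"
  have bT: "bounded_measurable M T" unfolding T_def
    using l by (intro bounded_measurable_sum bounded_measurable_mult bounded_measurable_const) auto
  have bA: "bounded_measurable M A" unfolding A_def
    by (intro bounded_measurable_power bounded_measurable_complex bT)
  have bB: "bounded_measurable M (\<lambda>x. 2 * Re (cnj (T x) * (\<omega> * l x a)))" if "a < D" for \<omega> a
    by (intro bounded_measurable_mult bounded_measurable_const bounded_measurable_complex bT l that)
  have bC: "bounded_measurable M (\<lambda>x. (cmod (l x a))\<^sup>2)" if "a < D" for a
    by (intro bounded_measurable_power bounded_measurable_complex l that)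
  have key: "(\<integral>x. (of_nat ?P * A x ^ p * (cmod (l x a))\<^sup>2 +
        of_nat (?P choose 2) * A x ^ (?P - 2) * (2 * Re (cnj (T x) * (\<omega> * l x a)))\<^sup>2) * R x \<partial>M) =
      c * (of_nat ?P * n ^ p + of_nat (?P choose 2) * n ^ (?P - 2) * (2 * Re (cnj (t a) * \<omega>))\<^sup>2)"
    if a: "a < D" and \<omega>: "cmod \<omega> = 1" for a \<omega>
  proof -
    have "(\<integral>x. coeff ([:A x, 2 * Re (cnj (T x) * (\<omega> * l x a)), (cmod (l x a))\<^sup>2:] ^ ?P) 2 * R x \<partial>M) =
        coeff (Polynomial.smult c ([:n, 2 * Re (cnj (t a) * \<omega>), 1:] ^ ?P)) 2"
    proof (rule integral_coeff_eq)
      fix j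
      show "integrable M (\<lambda>x. coeff ([:A x, 2 * Re (cnj (T x) * (\<omega> * l x a)), (cmod (l x a))\<^sup>2:] ^ ?P) j * R x)"
        by (intro bounded_measurable_integrable bounded_measurable_mult R
            bounded_measurable_coeff_quadratic_power bA bB bC a)
    next
      fix x
      show "degree ([:A x, 2 * Re (cnj (T x) * (\<omega> * l x a)), (cmod (l x a))\<^sup>2:] ^ ?P) \<le> 2 * ?P"
        by (rule order_trans[OF degree_power_le]) (auto intro!: mult_right_mono)
    next
      fix h :: real
      define t' where "t' b = t b + (if b = a then complex_of_real h * \<omega> else 0)" for b
      have T': "(\<Sum>b<D. t' b * l x b) = T x + complex_of_real h * (\<omega> * l x a)" for x
      proof -
        have "(\<Sum>b<D. t' b * l x b) = (\<Sum>b<D. t b * l x b + (if b = a then complex_of_real h * \<omega> * l x a else 0))"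
          by (intro sum.cong) (auto simp: t'_def algebra_simps)
        thus ?thesis using a by (simp add: sum.distrib T_def)
      qed
      have n': "(\<Sum>b<D. (cmod (t' b))\<^sup>2) = n + h * (2 * Re (cnj (t a) * \<omega>)) + h\<^sup>2"
      proof -
        have "(\<Sum>b<D. (cmod (t' b))\<^sup>2) = (\<Sum>b<D. (cmod (t b))\<^sup>2 + (if b = a then h * (2 * Re (cnj (t a) * \<omega>)) + h\<^sup>2 else 0))"
          by (intro sum.cong refl) (auto simp: t'_def cmod_add_square \<omega>)
        thus ?thesis using a by (simp add: sum.distrib n_def)
      qed
      have pw: "cmod z ^ (2 * ?P) = ((cmod z)\<^sup>2) ^ ?P" for z by (rule power_mult)
      have "(\<integral>x. ((cmod (T x + complex_of_real h * (\<omega> * l x a)))\<^sup>2) ^ ?P * R x \<partial>M) =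
          c * (n + h * (2 * Re (cnj (t a) * \<omega>)) + h\<^sup>2) ^ ?P"
        using iso[of t', unfolded pw T' n'] .
      moreover have "(cmod (T x + complex_of_real h * (\<omega> * l x a)))\<^sup>2 =
          poly [:A x, 2 * Re (cnj (T x) * (\<omega> * l x a)), (cmod (l x a))\<^sup>2:] h" for x
        unfolding cmod_add_square A_def by (simp add: norm_mult \<omega> power2_eq_square algebra_simps)
      moreover have "n + h * (2 * Re (cnj (t a) * \<omega>)) + h\<^sup>2 = poly [:n, 2 * Re (cnj (t a) * \<omega>), 1:] h"
        by (simp add: power2_eq_square algebra_simps)
      ultimately show "(\<integral>x. poly ([:A x, 2 * Re (cnj (T x) * (\<omega> * l x a)), (cmod (l x a))\<^sup>2:] ^ ?P) h * R x \<partial>M) =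
          poly (Polynomial.smult c ([:n, 2 * Re (cnj (t a) * \<omega>), 1:] ^ ?P)) h"
        by (simp only: poly_power poly_smult)
    qed
    thus ?thesis by (simp only: coeff_quadratic_power coeff_smult diff_Suc_1 mult_1_right)
  qed
  have int: "integrable M (\<lambda>x. (of_nat ?P * A x ^ p * (cmod (l x a))\<^sup>2 +
        of_nat (?P choose 2) * A x ^ (?P - 2) * (2 * Re (cnj (T x) * (\<omega> * l x a)))\<^sup>2) * R x)" if "a < D" for a \<omega>
    by (intro bounded_measurable_integrable bounded_measurable_mult bounded_measurable_add
        bounded_measurable_power R bA bB bC bounded_measurable_const bounded_measurable_complex bT l that)
  have ch: "2 * of_nat (?P choose 2) = real ?P * real p" 
    using choose_two[of ?P] by (metis diff_Suc_1 dvd_mult_div_cancel even_mult_iff even_Suc of_nat_mult of_nat_numeral)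
  \<comment> \<open>For \<open>p = 0\<close> the exponent \<open>?P - 2\<close> truncates to 0, but
    the binomial coefficient is then 0 on both sides.\<close>
  have low: "of_nat (?P choose 2) * s ^ (?P - 2) * s = of_nat (?P choose 2) * s ^ p" for s :: real
    by (cases p) (simp_all add: numeral_2_eq_2)
  \<comment> \<open>Adding the directions 1 and \<i> turns the squared real parts into squared
    moduli on both sides. On the left the two kinds of terms merge: with P = p + 1, the factor is 2
    P + 2 P p = 2 P^2.\<close>
  have pt: "(\<integral>x. A x ^ p * ((cmod (l x a))\<^sup>2 * R x) \<partial>M) * (2 * real ?P * real ?P) =
      c * (2 * of_nat ?P * n ^ p + 4 * (of_nat (?P choose 2) * n ^ (?P - 2) * (cmod (t a))\<^sup>2))" if a: "a < D" for a
  proof -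
    have "c * (2 * of_nat ?P * n ^ p + 4 * (of_nat (?P choose 2) * n ^ (?P - 2) * ((Re (cnj (t a)))\<^sup>2 + (Re (cnj (t a) * \<i>))\<^sup>2))) =
       c * (of_nat ?P * n ^ p + of_nat (?P choose 2) * n ^ (?P - 2) * (2 * Re (cnj (t a) * 1))\<^sup>2)
       + c * (of_nat ?P * n ^ p + of_nat (?P choose 2) * n ^ (?P - 2) * (2 * Re (cnj (t a) * \<i>))\<^sup>2)"
      by (simp add: algebra_simps power_mult_distrib)
    also have "\<dots> = (\<integral>x. (of_nat ?P * A x ^ p * (cmod (l x a))\<^sup>2 +
        of_nat (?P choose 2) * A x ^ (?P - 2) * (2 * Re (cnj (T x) * (1 * l x a)))\<^sup>2) * R x
       + (of_nat ?P * A x ^ p * (cmod (l x a))\<^sup>2 +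
        of_nat (?P choose 2) * A x ^ (?P - 2) * (2 * Re (cnj (T x) * (\<i> * l x a)))\<^sup>2) * R x \<partial>M)"
      by (subst Bochner_Integration.integral_add[OF int[OF a] int[OF a]]) (simp only: key[OF a] norm_one norm_ii)
    also have "\<dots> = (\<integral>x. A x ^ p * ((cmod (l x a))\<^sup>2 * R x) * (2 * real ?P * real ?P) \<partial>M)"
    proof (intro Bochner_Integration.integral_cong refl)
      fix x
      have sq: "(2 * Re (cnj (T x) * (1 * l x a)))\<^sup>2 + (2 * Re (cnj (T x) * (\<i> * l x a)))\<^sup>2 = 4 * (A x * (cmod (l x a))\<^sup>2)"
      proof -
        have "(2 * Re (cnj (T x) * (1 * l x a)))\<^sup>2 + (2 * Re (cnj (T x) * (\<i> * l x a)))\<^sup>2 =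
          4 * ((Re (cnj (T x) * l x a))\<^sup>2 + (Re (cnj (T x) * l x a * \<i>))\<^sup>2)"
        proof -
          have "cnj (T x) * (\<i> * l x a) = cnj (T x) * l x a * \<i>" by (simp only: mult_ac)
          moreover have "(2 * r)\<^sup>2 + (2 * q)\<^sup>2 = 4 * (r\<^sup>2 + q\<^sup>2)" for r q :: real
            by (simp add: power2_eq_square)
          ultimately show ?thesis by (simp only: mult_1_left)
        qed
        thus ?thesis unfolding Re_square_add_Re_ii_square by (simp add: norm_mult power_mult_distrib A_def)
      qed
      have "(of_nat ?P * A x ^ p * (cmod (l x a))\<^sup>2 +
        of_nat (?P choose 2) * A x ^ (?P - 2) * (2 * Re (cnj (T x) * (1 * l x a)))\<^sup>2) * R x
       + (of_nat ?P * A x ^ p * (cmod (l x a))\<^sup>2 +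
        of_nat (?P choose 2) * A x ^ (?P - 2) * (2 * Re (cnj (T x) * (\<i> * l x a)))\<^sup>2) * R x
        = (2 * of_nat ?P * A x ^ p * (cmod (l x a))\<^sup>2 + of_nat (?P choose 2) * A x ^ (?P - 2) *
           ((2 * Re (cnj (T x) * (1 * l x a)))\<^sup>2 + (2 * Re (cnj (T x) * (\<i> * l x a)))\<^sup>2)) * R x"
        by (simp only: distrib_left distrib_right)
      also have "\<dots> = (2 * of_nat ?P * A x ^ p + 4 * (of_nat (?P choose 2) * A x ^ (?P - 2) * A x)) * (cmod (l x a))\<^sup>2 * R x"
        unfolding sq by (simp add: algebra_simps)
      also have "\<dots> = (2 * real ?P + 2 * (2 * of_nat (?P choose 2))) * A x ^ p * (cmod (l x a))\<^sup>2 * R x"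
        unfolding low by (simp only: algebra_simps)
      also have "2 * real ?P + 2 * (2 * of_nat (?P choose 2)) = 2 * real ?P * real ?P"
        unfolding ch by (simp add: algebra_simps)
      finally show "(of_nat ?P * A x ^ p * (cmod (l x a))\<^sup>2 +
        of_nat (?P choose 2) * A x ^ (?P - 2) * (2 * Re (cnj (T x) * (1 * l x a)))\<^sup>2) * R x
       + (of_nat ?P * A x ^ p * (cmod (l x a))\<^sup>2 +
        of_nat (?P choose 2) * A x ^ (?P - 2) * (2 * Re (cnj (T x) * (\<i> * l x a)))\<^sup>2) * R x =
        A x ^ p * ((cmod (l x a))\<^sup>2 * R x) * (2 * real ?P * real ?P)" by (simp only: mult_ac)
    qed
    also have "\<dots> = (\<integral>x. A x ^ p * ((cmod (l x a))\<^sup>2 * R x) \<partial>M) * (2 * real ?P * real ?P)"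
      by (rule integral_mult_left_zero)
    finally show ?thesis unfolding Re_square_add_Re_ii_square by simp
  qed
  have "(\<integral>x. A x ^ p * ((\<Sum>a<D. (cmod (l x a))\<^sup>2) * R x) \<partial>M) =
      (\<Sum>a<D. \<integral>x. A x ^ p * ((cmod (l x a))\<^sup>2 * R x) \<partial>M)"
    unfolding sum_distrib_left sum_distrib_right
    by (intro Bochner_Integration.integral_sum bounded_measurable_integrable bounded_measurable_mult
        bounded_measurable_power R bA bC bounded_measurable_complex l) auto
  hence "(\<integral>x. A x ^ p * ((\<Sum>a<D. (cmod (l x a))\<^sup>2) * R x) \<partial>M) * (2 * real ?P * real ?P) =
      (\<Sum>a<D. c * (2 * of_nat ?P * n ^ p + 4 * (of_nat (?P choose 2) * n ^ (?P - 2) * (cmod (t a))\<^sup>2)))"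
    using pt by (simp add: sum_distrib_right del: of_nat_Suc)
  also have "\<dots> = c * (real D * (2 * of_nat ?P * n ^ p) + 4 * (of_nat (?P choose 2) * n ^ (?P - 2) * n))"
    by (simp only: sum_distrib_left[symmetric] sum.distrib n_def) simp
  also have "\<dots> = c * (real D * (2 * of_nat ?P * n ^ p) + 2 * (2 * of_nat (?P choose 2)) * n ^ p)"
    unfolding low by simp
  also have "\<dots> = c * (real D + real p) * n ^ p * (2 * real ?P)"
    unfolding ch by (simp only: algebra_simps)
  \<comment> \<open>After summation over the coordinates the left side carries 2 (p + 1)^2 and the
    right side 2 (p + 1) (D + p); the quotient is the factor of the step.\<close>
  finally have "(\<integral>x. A x ^ p * ((\<Sum>a<D. (cmod (l x a))\<^sup>2) * R x) \<partial>M) * real ?P = c * (real D + real p) * n ^ p"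
    by simp
  thus ?thesis by (simp add: A_def T_def n_def power_mult[symmetric] field_simps)
qed

text \<open>Each step trades one factor of the squared pairing with \<open>t\<close> for one factor
  of the squared norm, which is carried along in the weight \<open>R\<close>. Going down from
  \<open>p = k\<close> to \<open>p = 0\<close>, the test vector \<open>t\<close> disappears and a
  pure norm moment remains.\<close>

lemma (in finite_measure) isotropic_norm_moment:
  fixes l :: "'a \<Rightarrow> nat \<Rightarrow> complex"
  assumes l: "\<And>a. a < D \<Longrightarrow> bounded_measurable M (\<lambda>x. l x a)"
    and iso: "\<And>t. (\<integral>x. (cmod (\<Sum>a<D. t a * l x a)) ^ (2 * k) \<partial>M) = c * (\<Sum>a<D. (cmod (t a))\<^sup>2) ^ k"
  shows "(\<integral>x. (\<Sum>a<D. (cmod (l x a))\<^sup>2) ^ k \<partial>M) = c * (\<Prod>i<k. (real D + real i) / real (Suc i))"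
proof -
  define S where "S x = (\<Sum>a<D. (cmod (l x a))\<^sup>2)" for x
  have bS: "bounded_measurable M S" unfolding S_def
    using l by (intro bounded_measurable_sum bounded_measurable_power bounded_measurable_complex) auto
  have "(\<integral>x. (cmod (\<Sum>a<D. t a * l x a)) ^ (2 * p) * S x ^ (k - p) \<partial>M) =
      c * (\<Prod>i\<in>{p..<k}. (real D + real i) / real (Suc i)) * (\<Sum>a<D. (cmod (t a))\<^sup>2) ^ p" if "p \<le> k" for p t
    using that
  proof (induction p arbitrary: t rule: inc_induct)
    case base
    show ?case using iso by simp
  next
    case (step p)
    have "S x ^ (k - p) = S x * S x ^ (k - Suc p)" for x
      using step(2) by (simp add: power_Suc[symmetric] Suc_diff_Suc del: power_Suc)
    moreover have "(\<Prod>i\<in>{p..<k}. (real D + real i) / real (Suc i)) =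
        (real D + real p) / real (Suc p) * (\<Prod>i\<in>{Suc p..<k}. (real D + real i) / real (Suc i))"
      using step(2) by (simp add: prod.atLeast_Suc_lessThan)
    ultimately show ?case
      using isotropic_moment_step[OF l bounded_measurable_power[OF bS] step(3), of t]
      by (simp add: S_def mult_ac del: of_nat_Suc)
  qed
  from this[of 0] show ?thesis by (simp add: S_def lessThan_atLeast0)
qed

text \<open>Jensen's inequality for x^k at the points a_e W / w_e with weights w_e / W, where W is
  the sum of the w_e. Indices with \<open>w e = 0\<close> contribute nothing on either side because
  \<open>a e = 0\<close> there.\<close>

lemma sum_power_le_weighted:
  fixes a w :: "'e \<Rightarrow> real"
  assumes I: "finite I" and k: "0 < k" and a: "\<And>e. e \<in> I \<Longrightarrow> 0 \<le> a e" and w: "\<And>e. e \<in> I \<Longrightarrow> 0 \<le> w e"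
    and z: "\<And>e. e \<in> I \<Longrightarrow> w e = 0 \<Longrightarrow> a e = 0"
  shows "(\<Sum>e\<in>I. a e) ^ k \<le> (\<Sum>e\<in>I. w e) ^ (k - 1) * (\<Sum>e\<in>I. a e ^ k / w e ^ (k - 1))"
proof (cases "(\<Sum>e\<in>I. w e) = 0")
  case True
  hence "\<forall>e\<in>I. w e = 0" using I w by (simp add: sum_nonneg_eq_0_iff)
  hence "\<forall>e\<in>I. a e = 0" using z by blast
  thus ?thesis using k by (simp add: zero_power)
next
  case False
  define W where "W = (\<Sum>e\<in>I. w e)"
  have W: "W > 0" using False w by (simp add: W_def sum_nonneg order_less_le)
  have ne: "I \<noteq> {}" using False by auto
  have cvx: "convex_on {0..} (\<lambda>x::real. x ^ k)"
    by (cases "even k") (auto intro: convex_power_odd convex_on_subset[OF convex_power_even])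
  have "(\<Sum>e\<in>I. (w e / W) *\<^sub>R (a e * W / w e)) ^ k \<le> (\<Sum>e\<in>I. (w e / W) * (a e * W / w e) ^ k)"
    using I ne W a w
    by (intro convex_on_sum[OF I ne cvx]) (auto simp: sum_divide_distrib[symmetric] W_def[symmetric])
  also have "(\<Sum>e\<in>I. (w e / W) *\<^sub>R (a e * W / w e)) = (\<Sum>e\<in>I. a e)"
    using W z by (intro sum.cong) auto
  also have "(\<Sum>e\<in>I. (w e / W) * (a e * W / w e) ^ k) = (\<Sum>e\<in>I. W ^ (k - 1) * (a e ^ k / w e ^ (k - 1)))"
  proof (intro sum.cong refl)
    fix e assume e: "e \<in> I"
    obtain j where j: "k = Suc j" using k by (cases k) auto
    show "(w e / W) * (a e * W / w e) ^ k = W ^ (k - 1) * (a e ^ k / w e ^ (k - 1))"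
      using W z[OF e] by (cases "w e = 0") (simp_all add: j power_mult_distrib power_divide)
  qed
  finally show ?thesis by (simp add: W_def sum_distrib_left)
qed

text \<open>This is the triangle inequality in L^k for functions of norm r^(1/k) w_e, written
  without roots. Taking these same w_e as Jensen weights makes each term integrate to r w_e, so the
  bound closes up. It tolerates arbitrary dependence among the summands.\<close>

lemma (in finite_measure) integral_sum_power_le:
  fixes f :: "'e \<Rightarrow> 'a \<Rightarrow> real" and w :: "'e \<Rightarrow> real"
  assumes I: "finite I" and k: "0 < k" and bm: "\<And>e. e \<in> I \<Longrightarrow> bounded_measurable M (f e)"
    and f: "\<And>e x. e \<in> I \<Longrightarrow> 0 \<le> f e x" and w: "\<And>e. e \<in> I \<Longrightarrow> 0 \<le> w e"
    and z: "\<And>e x. e \<in> I \<Longrightarrow> w e = 0 \<Longrightarrow> f e x = 0"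
    and int: "\<And>e. e \<in> I \<Longrightarrow> (\<integral>x. f e x ^ k \<partial>M) = r * w e ^ k"
  shows "(\<integral>x. (\<Sum>e\<in>I. f e x) ^ k \<partial>M) \<le> r * (\<Sum>e\<in>I. w e) ^ k"
proof -
  obtain j where j: "k = Suc j" using k by (cases k) auto
  have "(\<integral>x. (\<Sum>e\<in>I. f e x) ^ k \<partial>M) \<le>
      (\<integral>x. (\<Sum>e\<in>I. w e) ^ (k - 1) * (\<Sum>e\<in>I. f e x ^ k * (1 / w e ^ (k - 1))) \<partial>M)"
  proof (rule integral_mono)
    fix x
    show "(\<Sum>e\<in>I. f e x) ^ k \<le> (\<Sum>e\<in>I. w e) ^ (k - 1) * (\<Sum>e\<in>I. f e x ^ k * (1 / w e ^ (k - 1)))"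
      using sum_power_le_weighted[of I k "\<lambda>e. f e x" w] I k f w z by simp
  qed (intro bounded_measurable_integrable bounded_measurable_mult bounded_measurable_sum
      bounded_measurable_power bounded_measurable_const bm; assumption)+
  also have "\<dots> = (\<Sum>e\<in>I. w e) ^ (k - 1) * (\<Sum>e\<in>I. (\<integral>x. f e x ^ k \<partial>M) * (1 / w e ^ (k - 1)))"
    by (simp only: integral_mult_right_zero)
       (subst Bochner_Integration.integral_sum; 
        (intro bounded_measurable_integrable bounded_measurable_mult bounded_measurable_power bounded_measurable_const bm)?; simp)
  also have "(\<Sum>e\<in>I. (\<integral>x. f e x ^ k \<partial>M) * (1 / w e ^ (k - 1))) = (\<Sum>e\<in>I. r * w e)"
  proof (intro sum.cong refl)
    fix e assume "e \<in> I"
    thus "(\<integral>x. f e x ^ k \<partial>M) * (1 / w e ^ (k - 1)) = r * w e"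
      by (cases "w e = 0") (simp_all only: int, simp_all add: j)
  qed
  also have "(\<Sum>e\<in>I. w e) ^ (k - 1) * (\<Sum>e\<in>I. r * w e) = r * (\<Sum>e\<in>I. w e) ^ k"
    by (simp add: j sum_distrib_left[symmetric])
  finally show ?thesis .
qed

section \<open>The circuit amplitude as a trace\<close>

lemma sum_bits_eq_horner_sum:
  "(\<Sum>q<n. of_bool (P q) * 2 ^ q) = (horner_sum of_bool 2 (map P [0..<n]) :: nat)"
  by (simp add: horner_sum_eq_sum lessThan_atLeast0)

lemma bit_sum_bits: "bit (\<Sum>q<n. of_bool (P q) * 2 ^ q :: nat) l \<longleftrightarrow> l < n \<and> P l"
  unfolding sum_bits_eq_horner_sum by (auto simp: bit_horner_sum_bit_iff)

lemma sum_bits_less: "(\<Sum>q<n. of_bool (P q) * 2 ^ q :: nat) < 2 ^ n"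
  unfolding sum_bits_eq_horner_sum using horner_sum_of_bool_2_less[of "map P [0..<n]"] by simp

lemma bit_imp_less: "x < 2 ^ n \<Longrightarrow> bit (x :: nat) q \<Longrightarrow> q < n"
  by (metis bit_take_bit_iff take_bit_nat_eq_self)

lemma eq_if_bits_eq: "x < 2 ^ n \<Longrightarrow> y < 2 ^ n \<Longrightarrow> (\<And>q. q < n \<Longrightarrow> bit x q = bit y q) \<Longrightarrow> x = (y :: nat)"
  by (metis bit_imp_less bit_eq_iff)

lemma bit_sub_label: "bit (sub_label qs x) l \<longleftrightarrow> l < length qs \<and> bit x (qs ! l)"
  unfolding sub_label_def by (rule bit_sum_bits)

lemma sub_label_less: "sub_label qs x < 2 ^ length qs"
  unfolding sub_label_def by (rule sum_bits_less)

lemma sub_label_cong: "(\<And>q. q \<in> set qs \<Longrightarrow> bit x q = bit y q) \<Longrightarrow> sub_label qs x = sub_label qs y"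
  unfolding sub_label_def by (intro sum.cong) auto

lemma sub_label_0: "sub_label qs 0 = 0"
  by (simp add: sub_label_def)

lemma sub_label_append: "sub_label (xs @ ys) x = sub_label xs x + 2 ^ length xs * sub_label ys x"
proof -
  have "(\<Sum>l<a + b. f l) = (\<Sum>l<a. f l) + (\<Sum>l<b. f (a + l))" for f :: "nat \<Rightarrow> nat" and a b
    by (induction b) auto
  thus ?thesis
    by (simp add: sub_label_def nth_append sum_distrib_left power_add mult_ac
        del: sum_of_bool_mult_eq sum_mult_of_bool_eq)
qed

text \<open>No qubit is touched twice when the supports are disjoint, so each matrix product has a
  single contributing intermediate state and the entry is a product of block entries.\<close>

lemma on_qubits_product_index:
  assumes "distinct ss" and "\<And>s. s \<in> set ss \<Longrightarrow> set (Q s) \<subseteq> {..<n}"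
    and "\<And>s s'. s \<in> set ss \<Longrightarrow> s' \<in> set ss \<Longrightarrow> s \<noteq> s' \<Longrightarrow> set (Q s) \<inter> set (Q s') = {}"
    and "x < 2 ^ n" "y < 2 ^ n"
  shows "foldr (\<lambda>s A. on_qubits n (Q s) (V s) * A) ss (1\<^sub>m (2 ^ n)) $$ (x, y) =
    (if \<forall>q<n. q \<notin> (\<Union>s\<in>set ss. set (Q s)) \<longrightarrow> bit x q = bit y q
     then \<Prod>s\<in>set ss. V s $$ (sub_label (Q s) x, sub_label (Q s) y) else 0)"
  using assms
proof (induction ss arbitrary: x y)
  case Nil
  have "(\<forall>q<n. bit x q = bit y q) \<longleftrightarrow> x = y"
    using eq_if_bits_eq[OF Nil(4,5)] by auto
  thus ?case using Nil by simp
next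
  case (Cons s ss)
  let ?F = "foldr (\<lambda>s A. on_qubits n (Q s) (V s) * A) ss (1\<^sub>m (2 ^ n))"
  let ?U = "\<Union>s\<in>set ss. set (Q s)"
  have Fc: "foldr (\<lambda>s A. on_qubits n (Q s) (V s) * A) ts (1\<^sub>m (2 ^ n)) \<in> carrier_mat (2 ^ n) (2 ^ n)" for ts
    by (induction ts) (auto simp: on_qubits_def)
  have oc: "on_qubits n (Q s) (V s) \<in> carrier_mat (2 ^ n) (2 ^ n)" by (simp add: on_qubits_def)
  have disj: "q \<notin> ?U" if "q \<in> set (Q s)" for q
    using that Cons(2) Cons(4)[of s] by auto
  have IH: "?F $$ (z, y) = (if \<forall>q<n. q \<notin> ?U \<longrightarrow> bit z q = bit y q
     then \<Prod>s\<in>set ss. V s $$ (sub_label (Q s) z, sub_label (Q s) y) else 0)" if "z < 2 ^ n" for z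
    using Cons that by (intro Cons.IH) auto
  have e: "foldr (\<lambda>s A. on_qubits n (Q s) (V s) * A) (s # ss) (1\<^sub>m (2 ^ n)) $$ (x, y) =
      (\<Sum>z<2 ^ n. on_qubits n (Q s) (V s) $$ (x, z) * ?F $$ (z, y))"
    using mult_mat_index_sum[OF oc Fc Cons(5,6)] by simp
  \<comment> \<open>The surviving intermediate state: the block on \<open>Q s\<close> preserves the
    bits of \<open>x\<close> elsewhere, and the remaining blocks do not touch \<open>Q s\<close>, so
    there the bits must already be those of \<open>y\<close>.\<close>
  define w where "w = (\<Sum>q<n. of_bool (if q \<in> set (Q s) then bit y q else bit x q) * 2 ^ q :: nat)"
  have w: "w < 2 ^ n" unfolding w_def by (rule sum_bits_less)
  have bw: "bit w q \<longleftrightarrow> (if q \<in> set (Q s) then bit y q else bit x q)" if "q < n" for q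
    unfolding w_def bit_sum_bits using that by simp
  have only: "on_qubits n (Q s) (V s) $$ (x, z) * ?F $$ (z, y) = 0" if z: "z < 2 ^ n" "z \<noteq> w" for z
  proof (rule ccontr)
    assume "on_qubits n (Q s) (V s) $$ (x, z) * ?F $$ (z, y) \<noteq> 0"
    hence "\<forall>q<n. q \<notin> set (Q s) \<longrightarrow> bit x q = bit z q" "\<forall>q<n. q \<notin> ?U \<longrightarrow> bit z q = bit y q"
      using IH[OF z(1)] Cons(5) z(1) by (auto simp: on_qubits_def split: if_splits)
    hence "z = w" using disj by (intro eq_if_bits_eq[OF z(1) w]) (auto simp: bw)
    thus False using z by simp
  qed
  have "(\<Sum>z<2 ^ n. on_qubits n (Q s) (V s) $$ (x, z) * ?F $$ (z, y)) =
      (\<Sum>z\<in>{w}. on_qubits n (Q s) (V s) $$ (x, z) * ?F $$ (z, y))"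
    using w only by (intro sum.mono_neutral_right) auto
  also have "\<dots> = V s $$ (sub_label (Q s) x, sub_label (Q s) w) * ?F $$ (w, y)"
    using Cons(5) w bw by (auto simp: on_qubits_def)
  also have "sub_label (Q s) w = sub_label (Q s) y"
    using Cons(3)[of s] by (intro sub_label_cong) (auto simp: bw)
  also have "?F $$ (w, y) = (if \<forall>q<n. q \<notin> (\<Union>s\<in>set (s # ss). set (Q s)) \<longrightarrow> bit x q = bit y q
     then \<Prod>s\<in>set ss. V s $$ (sub_label (Q s) x, sub_label (Q s) y) else 0)"
  proof -
    have 1: "(\<forall>q<n. q \<notin> ?U \<longrightarrow> bit w q = bit y q) \<longleftrightarrow>
        (\<forall>q<n. q \<notin> (\<Union>s\<in>set (s # ss). set (Q s)) \<longrightarrow> bit x q = bit y q)"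
      using bw by auto
    have 2: "sub_label (Q s') w = sub_label (Q s') x" if "s' \<in> set ss" for s'
    proof (rule sub_label_cong)
      fix q assume q: "q \<in> set (Q s')"
      hence "q \<notin> set (Q s)" "q < n" using that disj[of q] Cons(3)[of s'] by auto
      thus "bit w q = bit x q" by (simp add: bw)
    qed
    show ?thesis unfolding IH[OF w] by (intro if_cong 1 prod.cong refl) (simp add: 2)
  qed
  finally have "(\<Sum>z<2 ^ n. on_qubits n (Q s) (V s) $$ (x, z) * ?F $$ (z, y)) =
     V s $$ (sub_label (Q s) x, sub_label (Q s) y) *
       (if \<forall>q<n. q \<notin> (\<Union>s\<in>set (s # ss). set (Q s)) \<longrightarrow> bit x q = bit y q
        then \<Prod>s\<in>set ss. V s $$ (sub_label (Q s) x, sub_label (Q s) y) else 0)" .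
  moreover have "(\<Prod>s\<in>set (s # ss). V s $$ (sub_label (Q s) x, sub_label (Q s) y)) =
      V s $$ (sub_label (Q s) x, sub_label (Q s) y) * (\<Prod>s\<in>set ss. V s $$ (sub_label (Q s) x, sub_label (Q s) y))"
    using Cons(2) by simp
  ultimately show ?case
    unfolding e by (simp only: mult_zero_right if_distrib[where f = "times (V s $$ (sub_label (Q s) x, sub_label (Q s) y))"])
qed

section \<open>Patches as base-D digits and layers as products of blocks\<close>

lemma set_patch: "0 < \<xi> \<Longrightarrow> set (patch \<xi> p) = {q. q div \<xi> = p}"
  unfolding patch_def set_upt
  by (auto simp only: atLeastLessThan_iff mem_Collect_eq less_eq_div_iff_mult_less_eq[symmetric]
      div_less_iff_less_mult[symmetric])

text \<open>The patch labels are the digits of \<open>y\<close> in base \<open>2 ^ \<xi>\<close>,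
  which later turns the sum over basis states into a sum over strings of matrix indices.\<close>

lemma sub_label_patch: "0 < \<xi> \<Longrightarrow> sub_label (patch \<xi> p) y = y div (2 ^ \<xi>) ^ p mod 2 ^ \<xi>"
proof -
  have "sub_label (patch \<xi> p) y = take_bit \<xi> (drop_bit (p * \<xi>) y)"
    by (rule bit_eqI) (auto simp: bit_sub_label bit_take_bit_iff bit_drop_bit_eq patch_def)
  thus ?thesis by (simp add: take_bit_eq_mod drop_bit_eq_div power_mult[symmetric] mult.commute)
qed

text \<open>Only row \<open>0\<close> of a second-layer (odd) superblock and column \<open>0\<close> of a first-layer one enter the
  amplitude; either is read as a \<open>D \<times> D\<close> matrix from its first patch to its second.\<close>

definition block_tensor :: "nat \<Rightarrow> nat \<Rightarrow> complex mat \<Rightarrow> nat \<Rightarrow> nat \<Rightarrow> complex" where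
  "block_tensor D s V a b = (if odd s then V $$ (0, a + D * b) else V $$ (a + D * b, 0))"

text \<open>Entry of the product M_j M_(j+1) ... M_(j+l-1). It is unrolled from the left so that the
  factor of smallest index can be split off and integrated out.\<close>

primrec matrix_chain :: "nat \<Rightarrow> (nat \<Rightarrow> nat \<Rightarrow> nat \<Rightarrow> complex) \<Rightarrow> nat \<Rightarrow> nat \<Rightarrow> nat \<Rightarrow> nat \<Rightarrow> complex" where
  "matrix_chain D M j 0 a b = of_bool (a = b)"
| "matrix_chain D M j (Suc l) a b = (\<Sum>c<D. M j a c * matrix_chain D M (Suc j) l c b)"

lemma layer_carrier: "layer m \<xi> V ss \<in> carrier_mat (2 ^ (m * \<xi>)) (2 ^ (m * \<xi>))"
  unfolding layer_def by (induction ss) (auto simp: on_qubits_def)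

lemma set_superblock_qubits:
  "0 < \<xi> \<Longrightarrow> set (superblock_qubits m \<xi> s) = {q. q div \<xi> = s \<or> q div \<xi> = Suc s mod m}"
  by (auto simp: superblock_qubits_def set_patch)

text \<open>A layer covers every qubit, so the condition on untouched bits becomes vacuous.
  Disjointness within the layer uses that \<open>m\<close> is even: a superblock of given parity
  starts on a patch of that parity and ends on one of the opposite parity, also at the
  wraparound.\<close>

lemma layer_index:
  assumes m: "even m" and \<xi>: "0 < \<xi>" and xy: "x < 2 ^ (m * \<xi>)" "y < 2 ^ (m * \<xi>)"
    and P: "P = even \<or> P = odd"
  shows "layer m \<xi> V (filter P [0..<m]) $$ (x, y) = (\<Prod>s\<in>{s. s < m \<and> P s}.
     V s $$ (sub_label (superblock_qubits m \<xi> s) x, sub_label (superblock_qubits m \<xi> s) y))"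
proof -
  let ?Q = "superblock_qubits m \<xi>"
  have ss: "set (filter P [0..<m]) = {s. s < m \<and> P s}" by auto
  have sub: "set (?Q s) \<subseteq> {..<m * \<xi>}" if "s < m" for s
    using that \<xi> mod_less_divisor[of m "Suc s"]
    by (auto simp: set_superblock_qubits div_less_iff_less_mult[symmetric])
  have par: "even (Suc s mod m) \<longleftrightarrow> odd s" for s
    using m by (simp add: dvd_mod_iff)
  have inj: "s = s'" if "Suc s mod m = Suc s' mod m" "s < m" "s' < m" for s s'
    using that by (auto simp: mod_Suc split: if_splits)
  have disj: "set (?Q s) \<inter> set (?Q s') = {}" if "s < m" "s' < m" "P s" "P s'" "s \<noteq> s'" for s s'
  proof -
    have "even s \<longleftrightarrow> even s'" using that P by auto
    hence "Suc s' mod m \<noteq> s" "Suc s mod m \<noteq> s'" using par[of s] par[of s'] by metis+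
    moreover have "Suc s mod m \<noteq> Suc s' mod m" using inj that by blast
    ultimately show ?thesis using that(5) unfolding set_superblock_qubits[OF \<xi>] by auto
  qed
  have cover: "q \<in> (\<Union>s\<in>{s. s < m \<and> P s}. set (?Q s))" if q: "q < m * \<xi>" for q
  proof -
    define p where "p = q div \<xi>"
    have p: "p < m" unfolding p_def using q by (rule less_mult_imp_div_less)
    show ?thesis
    proof (cases "P p")
      case True
      thus ?thesis using p \<xi> by (auto simp: set_superblock_qubits p_def)
    next
      case False
      define s where "s = (if p = 0 then m - 1 else p - 1)"
      have s: "s < m" "Suc s mod m = p" using p by (auto simp: s_def)
      hence "P s" using False P par[of s] by auto
      thus ?thesis using s \<xi> by (auto simp: set_superblock_qubits p_def intro!: exI[of _ s])
    qed
  qed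
  show ?thesis
    unfolding layer_def
    by (subst on_qubits_product_index) (use sub disj cover xy in \<open>auto simp: ss\<close>)
qed

text \<open>One intermediate basis state \<open>y\<close> is inserted between the layers. Its digit
  \<open>s\<close> is shared by superblock \<open>s\<close> and its cyclic predecessor, so the
  product closes up into a ring of contracted indices.\<close>

lemma two_layer_circuit_amplitude:
  assumes m: "even m" and \<xi>: "0 < \<xi>"
  shows "two_layer_circuit m \<xi> V $$ (0, 0) = (\<Sum>y<(2 ^ \<xi>) ^ m. \<Prod>s<m.
     block_tensor (2 ^ \<xi>) s (V s) (y div (2 ^ \<xi>) ^ s mod 2 ^ \<xi>) (y div (2 ^ \<xi>) ^ (Suc s mod m) mod 2 ^ \<xi>))"
proof -
  let ?Q = "superblock_qubits m \<xi>"
  have "two_layer_circuit m \<xi> V $$ (0, 0) = (\<Sum>y<2 ^ (m * \<xi>).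
      layer m \<xi> V (filter odd [0..<m]) $$ (0, y) * layer m \<xi> V (filter even [0..<m]) $$ (y, 0))"
    unfolding two_layer_circuit_def by (intro mult_mat_index_sum[OF layer_carrier layer_carrier]) auto
  also have "\<dots> = (\<Sum>y<2 ^ (m * \<xi>). (\<Prod>s<m. block_tensor (2 ^ \<xi>) s (V s)
     (y div (2 ^ \<xi>) ^ s mod 2 ^ \<xi>) (y div (2 ^ \<xi>) ^ (Suc s mod m) mod 2 ^ \<xi>)))"
  proof (intro sum.cong refl)
    fix y :: nat assume "y \<in> {..<2 ^ (m * \<xi>)}"
    hence y: "y < 2 ^ (m * \<xi>)" by simp
    have l: "sub_label (?Q s) y = y div (2 ^ \<xi>) ^ s mod 2 ^ \<xi> + 2 ^ \<xi> * (y div (2 ^ \<xi>) ^ (Suc s mod m) mod 2 ^ \<xi>)" for s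
      by (simp add: superblock_qubits_def sub_label_append sub_label_patch[OF \<xi>]) (simp add: patch_def)
    have "{..<m} = {s. s < m \<and> odd s} \<union> {s. s < m \<and> even s}" by auto
    hence "(\<Prod>s<m. block_tensor (2 ^ \<xi>) s (V s) (y div (2 ^ \<xi>) ^ s mod 2 ^ \<xi>) (y div (2 ^ \<xi>) ^ (Suc s mod m) mod 2 ^ \<xi>)) =
      (\<Prod>s\<in>{s. s < m \<and> odd s} \<union> {s. s < m \<and> even s}. block_tensor (2 ^ \<xi>) s (V s) (y div (2 ^ \<xi>) ^ s mod 2 ^ \<xi>) (y div (2 ^ \<xi>) ^ (Suc s mod m) mod 2 ^ \<xi>))"
      by simp
    also have "\<dots> = (\<Prod>s\<in>{s. s < m \<and> odd s}. V s $$ (0, sub_label (?Q s) y)) *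
        (\<Prod>s\<in>{s. s < m \<and> even s}. V s $$ (sub_label (?Q s) y, 0))"
      unfolding l by (subst prod.union_disjoint) (auto simp: block_tensor_def intro!: arg_cong2[where f = times] prod.cong)
    also have "\<dots> = layer m \<xi> V (filter odd [0..<m]) $$ (0, y) * layer m \<xi> V (filter even [0..<m]) $$ (y, 0)"
      using y by (simp add: layer_index[OF m \<xi>] sub_label_0)
    finally show "layer m \<xi> V (filter odd [0..<m]) $$ (0, y) * layer m \<xi> V (filter even [0..<m]) $$ (y, 0) =
      (\<Prod>s<m. block_tensor (2 ^ \<xi>) s (V s) (y div (2 ^ \<xi>) ^ s mod 2 ^ \<xi>) (y div (2 ^ \<xi>) ^ (Suc s mod m) mod 2 ^ \<xi>))" ..
  qed
  finally show ?thesis by (simp add: power_mult[symmetric] mult.commute)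
qed

text \<open>One summand of an entry of a product of \<open>l + 1\<close> matrices: the
  \<open>l\<close> intermediate indices are the base-D digits of \<open>y\<close>, lowest
  first.\<close>

primrec path_weight :: "nat \<Rightarrow> (nat \<Rightarrow> nat \<Rightarrow> nat \<Rightarrow> complex) \<Rightarrow> nat \<Rightarrow> nat \<Rightarrow> nat \<Rightarrow> nat \<Rightarrow> nat \<Rightarrow> complex" where
  "path_weight D M j 0 a y b = M j a b"
| "path_weight D M j (Suc l) a y b = M j a (y mod D) * path_weight D M (Suc j) l (y mod D) (y div D) b"

lemma sum_digit_split:
  fixes f :: "nat \<Rightarrow> 'a::comm_monoid_add"
  assumes "0 < D"
  shows "(\<Sum>y<D ^ Suc l. f y) = (\<Sum>a<D. \<Sum>y<D ^ l. f (a + D * y))"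
proof -
  have "(\<Sum>y<D ^ Suc l. f y) = (\<Sum>(a, y)\<in>{..<D} \<times> {..<D ^ l}. f (a + D * y))"
  proof (rule sum.reindex_bij_witness[where i = "\<lambda>(a, y). a + D * y" and j = "\<lambda>y. (y mod D, y div D)"])
    fix z assume "z \<in> {..<D} \<times> {..<D ^ l}"
    then obtain a y where z: "z = (a, y)" "a < D" "y < D ^ l" by auto
    have "a + D * y < D * Suc y" using z by simp
    also have "\<dots> \<le> D * D ^ l" using z by (intro mult_left_mono) auto
    finally show "(case z of (a, y) \<Rightarrow> a + D * y) \<in> {..<D ^ Suc l}" using z by simp
  qed (use assms in \<open>auto simp: less_mult_imp_div_less mult.commute\<close>)
  thus ?thesis by (simp add: sum.cartesian_product)
qed

lemma matrix_chain_eq_sum_path_weight: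
  "0 < D \<Longrightarrow> b < D \<Longrightarrow> matrix_chain D M j (Suc l) a b = (\<Sum>y<D ^ l. path_weight D M j l a y b)"
proof (induction l arbitrary: j a)
  case 0
  thus ?case by (simp add: of_bool_def if_distrib[of "\<lambda>x. _ * x"] cong: if_cong)
next
  case (Suc l)
  have "matrix_chain D M j (Suc (Suc l)) a b = (\<Sum>c<D. M j a c * matrix_chain D M (Suc j) (Suc l) c b)"
    by simp
  also have "\<dots> = (\<Sum>c<D. M j a c * (\<Sum>y<D ^ l. path_weight D M (Suc j) l c y b))"
    by (simp only: Suc.IH[OF Suc.prems])
  also have "\<dots> = (\<Sum>y<D ^ Suc l. path_weight D M j (Suc l) a y b)"
    unfolding sum_digit_split[OF Suc.prems(1)] by (intro sum.cong refl) (simp add: sum_distrib_left)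
  finally show ?case .
qed

lemma path_weight_eq_prod:
  assumes "a < D"
  shows "path_weight D M j l a y b = (\<Prod>i<l. M (j + i) ((a + D * y) div D ^ i mod D) ((a + D * y) div D ^ Suc i mod D)) *
     M (j + l) ((a + D * y) div D ^ l mod D) b"
  using assms
proof (induction l arbitrary: j a y)
  case (Suc l)
  have D: "y mod D < D" using Suc.prems by simp
  have s: "(a + D * y) div D ^ Suc i = y div D ^ i" for i
    using Suc.prems by (simp add: div_mult2_eq)
  have "path_weight D M j (Suc l) a y b = M j a (y mod D) *
     ((\<Prod>i<l. M (Suc j + i) (y div D ^ i mod D) (y div D ^ Suc i mod D)) * M (Suc j + l) (y div D ^ l mod D) b)"
    using Suc.IH[OF D, of "Suc j" "y div D"] by (simp add: mod_mult_div_eq)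
  also have "\<dots> = (\<Prod>i<Suc l. M (j + i) ((a + D * y) div D ^ i mod D) ((a + D * y) div D ^ Suc i mod D)) *
     M (j + Suc l) ((a + D * y) div D ^ Suc l mod D) b"
    unfolding prod.lessThan_Suc_shift s using Suc.prems s[of 0] by (simp add: mult_ac)
  finally show ?case .
qed simp

text \<open>Splitting off the lowest digit as the start index \<open>a\<close> leaves a sum over
  paths of \<open>m - 1\<close> intermediate indices; the wraparound forces the path to return to
  \<open>a\<close>.\<close>

lemma cyclic_sum_eq_trace:
  assumes D: "0 < D" and m: "0 < m"
  shows "(\<Sum>y<D ^ m. \<Prod>s<m. M s (y div D ^ s mod D) (y div D ^ (Suc s mod m) mod D)) =
    (\<Sum>a<D. matrix_chain D M 0 m a a)"
proof -
  obtain l where l: "m = Suc l" using m by (cases m) auto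
  have "(\<Sum>a<D. matrix_chain D M 0 m a a) = (\<Sum>a<D. \<Sum>y<D ^ l. path_weight D M 0 l a y a)"
    unfolding l using D by (intro sum.cong) (auto simp: matrix_chain_eq_sum_path_weight simp del: matrix_chain.simps)
  also have "\<dots> = (\<Sum>a<D. \<Sum>y<D ^ l. \<Prod>s<m. M s ((a + D * y) div D ^ s mod D) ((a + D * y) div D ^ (Suc s mod m) mod D))"
    by (intro sum.cong refl) (simp add: path_weight_eq_prod l)
  also have "\<dots> = (\<Sum>y<D ^ m. \<Prod>s<m. M s (y div D ^ s mod D) (y div D ^ (Suc s mod m) mod D))"
    unfolding l sum_digit_split[OF D] ..
  finally show ?thesis ..
qed

section \<open>Moments of the circuit amplitude\<close>

lemma unitary_entry_le_1:
  assumes "unitary_mat U" "U \<in> carrier_mat N N" "i < N" "j < N"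
  shows "cmod (U $$ (i, j)) \<le> 1"
proof -
  have "complex_of_real (\<Sum>c<N. (cmod (U $$ (i, c)))\<^sup>2) = 1"
    using unitary_mat_rows[OF assms(1,2,3,3)] by (simp only: of_real_sum complex_norm_square of_bool_eq simp_thms)
  hence "(\<Sum>c<N. (cmod (U $$ (i, c)))\<^sup>2) = 1" using of_real_eq_1_iff by blast
  moreover have "(cmod (U $$ (i, j)))\<^sup>2 \<le> (\<Sum>c<N. (cmod (U $$ (i, c)))\<^sup>2)"
    using assms by (intro member_le_sum) auto
  ultimately show ?thesis by (simp add: power_le_one_iff abs_square_le_1)
qed

lemma haar_bounded_measurable_entry:
  assumes "is_haar N (USp N J) \<mu>" "i < N" "j < N"
  shows "bounded_measurable \<mu> (\<lambda>U. U $$ (i, j))"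
  unfolding bounded_measurable_def
  using haar_measurable_entry[OF assms] unitary_entry_le_1 is_haarD(2)[OF assms(1)] assms(2,3)
  by (auto simp: USp_def intro!: exI[of _ 1])

text \<open>A column of a unitary matrix has norm 1, so the norm moment of this isotropic vector is
  1, and the resulting identity is solved for the isotropy constant.\<close>

lemma haar_zero_amplitude_moment:
  assumes h: "is_haar N (USp N J) \<mu>" and J: "symplectic_form N J" and N: "3 \<le> N"
  shows "zero_amplitude_moment \<mu> k = (\<Prod>i<k. real (Suc i) / (real N + real i))"
proof -
  interpret prob_space \<mu> by (rule is_haarD(1)[OF h])
  have "(\<integral>U. (\<Sum>a<N. (cmod (U $$ (a, 0)))\<^sup>2) ^ k \<partial>\<mu>) =
      zero_amplitude_moment \<mu> k * (\<Prod>i<k. (real N + real i) / real (Suc i))"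
  proof (rule isotropic_norm_moment)
    fix t
    show "(\<integral>U. (cmod (\<Sum>a<N. t a * U $$ (a, 0))) ^ (2 * k) \<partial>\<mu>) =
        zero_amplitude_moment \<mu> k * (\<Sum>a<N. (cmod (t a))\<^sup>2) ^ k"
      using haar_column_moment[OF h J N, of t k] by (simp add: mult.commute)
  qed (use N in \<open>auto intro: haar_bounded_measurable_entry[OF h]\<close>)
  moreover have "(\<integral>U. (\<Sum>a<N. (cmod (U $$ (a, 0)))\<^sup>2) ^ k \<partial>\<mu>) = (\<integral>U. 1 \<partial>\<mu>)"
  proof (intro Bochner_Integration.integral_cong refl)
    fix U assume "U \<in> space \<mu>"
    hence U: "U \<in> carrier_mat N N" "unitary_mat U" using is_haarD(2)[OF h] by (auto simp: USp_def)
    have "complex_of_real (\<Sum>a<N. (cmod (U $$ (a, 0)))\<^sup>2) = (\<Sum>a<N. cnj (U $$ (a, 0)) * U $$ (a, 0))"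
      by (simp only: of_real_sum complex_norm_square mult.commute)
    hence "complex_of_real (\<Sum>a<N. (cmod (U $$ (a, 0)))\<^sup>2) = 1"
      using unitary_mat_cols[OF U(2,1), of 0 0] N by simp
    hence "(\<Sum>a<N. (cmod (U $$ (a, 0)))\<^sup>2) = 1" using of_real_eq_1_iff by blast
    thus "(\<Sum>a<N. (cmod (U $$ (a, 0)))\<^sup>2) ^ k = 1" by simp
  qed
  ultimately have A: "zero_amplitude_moment \<mu> k * (\<Prod>i<k. (real N + real i) / real (Suc i)) = 1"
    by (simp add: prob_space)
  have B: "(\<Prod>i<k. (real N + real i) / real (Suc i)) * (\<Prod>i<k. real (Suc i) / (real N + real i)) = 1"
  proof -
    have "(\<Prod>i<k. (real N + real i) / real (Suc i) * (real (Suc i) / (real N + real i))) = 1"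
    proof (intro prod.neutral ballI)
      fix i
      have "real N + real i \<noteq> 0" "real (Suc i) \<noteq> 0" using N by linarith+
      thus "(real N + real i) / real (Suc i) * (real (Suc i) / (real N + real i)) = 1" by simp
    qed
    thus ?thesis by (simp only: prod.distrib)
  qed
  have "zero_amplitude_moment \<mu> k = zero_amplitude_moment \<mu> k *
      ((\<Prod>i<k. (real N + real i) / real (Suc i)) * (\<Prod>i<k. real (Suc i) / (real N + real i)))"
    by (simp only: B mult_1_right)
  also have "\<dots> = (\<Prod>i<k. real (Suc i) / (real N + real i))"
    by (simp only: mult.assoc[symmetric] A mult_1_left)
  finally show ?thesis .
qed

lemma block_tensor_moment:
  assumes h: "is_haar (D * D) (USp (D * D) J) \<mu>" and J: "symplectic_form (D * D) J" and D: "2 \<le> D"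
  shows "(\<integral>V. (cmod (\<Sum>a<D. \<Sum>b<D. block_tensor D s V a b * x a b)) ^ (2 * k) \<partial>\<mu>) =
    zero_amplitude_moment \<mu> k * (\<Sum>a<D. \<Sum>b<D. (cmod (x a b))\<^sup>2) ^ k"
proof -
  have N: "3 \<le> D * D" using mult_le_mono[OF D D] by simp
  have split: "(\<Sum>j<D * D. f j) = (\<Sum>a<D. \<Sum>b<D. f (a + D * b))" for f :: "nat \<Rightarrow> 'z::comm_monoid_add"
    using sum_digit_split[of D f 1] D by simp
  define z where "z j = x (j mod D) (j div D)" for j
  have z: "z (a + D * b) = x a b" if "a < D" for a b using that by (simp add: z_def)
  have norm: "(\<Sum>j<D * D. (cmod (z j))\<^sup>2) = (\<Sum>a<D. \<Sum>b<D. (cmod (x a b))\<^sup>2)"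
    unfolding split by (simp add: z)
  have "(\<Sum>a<D. \<Sum>b<D. block_tensor D s V a b * x a b) =
     (if odd s then \<Sum>j<D * D. V $$ (0, j) * z j else \<Sum>j<D * D. V $$ (j, 0) * z j)" for V
    unfolding split by (simp add: z block_tensor_def)
  thus ?thesis
    using haar_row_moment[OF h J N, of z k] haar_column_moment[OF h J N, of z k]
    by (cases "odd s") (simp_all add: norm)
qed

lemma digit_pair_less: "a < D \<Longrightarrow> b < D \<Longrightarrow> a + D * b < D * (D :: nat)"
proof -
  assume "a < D" "b < D"
  hence "a + D * b < D * Suc b" by simp
  also have "\<dots> \<le> D * D" using \<open>b < D\<close> by (intro mult_le_mono) auto
  finally show ?thesis .
qed

lemma bounded_measurable_block_tensor:
  assumes h: "is_haar (D * D) (USp (D * D) J) \<mu>" and "a < D" "b < D"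
  shows "bounded_measurable \<mu> (\<lambda>V. block_tensor D s V a b)"
proof -
  have "0 < D * D" using assms(2) by (cases D) auto
  thus ?thesis using digit_pair_less[OF assms(2,3)]
    by (cases "odd s") (auto simp: block_tensor_def intro!: haar_bounded_measurable_entry[OF h])
qed

text \<open>Pairing M y with \<open>t\<close> is pairing the flattened block with the rank-one array
  t_a y_b, whose squared norm is |t|^2 |y|^2. Hence M y is isotropic of length \<open>D\<close>, and
  its norm moment combines with the Haar constant for dimension D^2.\<close>

lemma block_tensor_vector_moment:
  assumes h: "is_haar (D * D) (USp (D * D) J) \<mu>" and J: "symplectic_form (D * D) J" and D: "2 \<le> D"
  shows "(\<integral>V. (\<Sum>a<D. (cmod (\<Sum>b<D. block_tensor D s V a b * y b))\<^sup>2) ^ k \<partial>\<mu>) =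
    (\<Prod>i<k. (real D + real i) / (real (D * D) + real i)) * (\<Sum>b<D. (cmod (y b))\<^sup>2) ^ k"
proof -
  interpret prob_space \<mu> by (rule is_haarD(1)[OF h])
  have N: "3 \<le> D * D" using mult_le_mono[OF D D] by simp
  have A: "(\<integral>V. (\<Sum>a<D. (cmod (\<Sum>b<D. block_tensor D s V a b * y b))\<^sup>2) ^ k \<partial>\<mu>) =
     zero_amplitude_moment \<mu> k * (\<Sum>b<D. (cmod (y b))\<^sup>2) ^ k * (\<Prod>i<k. (real D + real i) / real (Suc i))"
  proof (rule isotropic_norm_moment)
    fix a assume "a < D"
    thus "bounded_measurable \<mu> (\<lambda>V. \<Sum>b<D. block_tensor D s V a b * y b)"
      by (intro bounded_measurable_sum bounded_measurable_mult bounded_measurable_const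
          bounded_measurable_block_tensor[OF h]) auto
  next
    fix t :: "nat \<Rightarrow> complex"
    have "(\<Sum>a<D. t a * (\<Sum>b<D. block_tensor D s V a b * y b)) =
        (\<Sum>a<D. \<Sum>b<D. block_tensor D s V a b * (t a * y b))" for V
      by (simp add: sum_distrib_left mult_ac)
    moreover have "(\<Sum>a<D. \<Sum>b<D. (cmod (t a * y b))\<^sup>2) = (\<Sum>a<D. (cmod (t a))\<^sup>2) * (\<Sum>b<D. (cmod (y b))\<^sup>2)"
      by (simp add: sum_product norm_mult power_mult_distrib)
    ultimately show "(\<integral>V. (cmod (\<Sum>a<D. t a * (\<Sum>b<D. block_tensor D s V a b * y b))) ^ (2 * k) \<partial>\<mu>) =
        zero_amplitude_moment \<mu> k * (\<Sum>b<D. (cmod (y b))\<^sup>2) ^ k * (\<Sum>a<D. (cmod (t a))\<^sup>2) ^ k"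
      using block_tensor_moment[OF h J D, of s "\<lambda>a b. t a * y b" k] by (simp add: power_mult_distrib mult_ac)
  qed
  have B: "zero_amplitude_moment \<mu> k * (\<Prod>i<k. (real D + real i) / real (Suc i)) =
      (\<Prod>i<k. (real D + real i) / (real (D * D) + real i))"
    unfolding haar_zero_amplitude_moment[OF h J N] prod.distrib[symmetric] by (intro prod.cong refl) simp
  show ?thesis unfolding A B[symmetric] by (simp only: mult_ac)
qed

text \<open>The squared Frobenius norm is summed column by column, each column having an exact
  moment, and the dependent columns are combined by the L^k triangle inequality. The nonnegative
  integral is the form needed for iteration.\<close>

lemma block_tensor_matrix_moment:
  assumes h: "is_haar (D * D) (USp (D * D) J) \<mu>" and J: "symplectic_form (D * D) J" and D: "2 \<le> D" and k: "0 < k"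
  shows "(\<integral>\<^sup>+V. ennreal ((\<Sum>a<D. \<Sum>e<D. (cmod (\<Sum>b<D. block_tensor D s V a b * Y b e))\<^sup>2) ^ k) \<partial>\<mu>) \<le>
    ennreal ((\<Prod>i<k. (real D + real i) / (real (D * D) + real i)) * (\<Sum>b<D. \<Sum>e<D. (cmod (Y b e))\<^sup>2) ^ k)"
proof -
  interpret prob_space \<mu> by (rule is_haarD(1)[OF h])
  define f where "f e V = (\<Sum>a<D. (cmod (\<Sum>b<D. block_tensor D s V a b * Y b e))\<^sup>2)" for e V
  have bm: "bounded_measurable \<mu> (f e)" if "e < D" for e
    unfolding f_def by (intro bounded_measurable_sum bounded_measurable_power bounded_measurable_complex
        bounded_measurable_mult bounded_measurable_const bounded_measurable_block_tensor[OF h]) auto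
  have "(\<integral>V. (\<Sum>e<D. f e V) ^ k \<partial>\<mu>) \<le>
     (\<Prod>i<k. (real D + real i) / (real (D * D) + real i)) * (\<Sum>e<D. \<Sum>b<D. (cmod (Y b e))\<^sup>2) ^ k"
  proof (rule integral_sum_power_le[OF _ k])
    fix e V assume "e \<in> {..<D}" "(\<Sum>b<D. (cmod (Y b e))\<^sup>2) = 0"
    thus "f e V = 0" by (simp add: f_def sum_nonneg_eq_0_iff)
  next
    fix e assume "e \<in> {..<D}"
    show "(\<integral>V. f e V ^ k \<partial>\<mu>) =
        (\<Prod>i<k. (real D + real i) / (real (D * D) + real i)) * (\<Sum>b<D. (cmod (Y b e))\<^sup>2) ^ k"
      unfolding f_def by (rule block_tensor_vector_moment[OF h J D])
  next
    fix e assume "e \<in> {..<D}" thus "bounded_measurable \<mu> (f e)" by (intro bm) simp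
  qed (auto intro: sum_nonneg simp: f_def)
  moreover have "integrable \<mu> (\<lambda>V. (\<Sum>e<D. f e V) ^ k)"
    using bm by (intro bounded_measurable_integrable bounded_measurable_power bounded_measurable_sum) auto
  hence "(\<integral>\<^sup>+V. ennreal ((\<Sum>e<D. f e V) ^ k) \<partial>\<mu>) = ennreal (\<integral>V. (\<Sum>e<D. f e V) ^ k \<partial>\<mu>)"
    by (intro nn_integral_eq_integral) (auto intro!: AE_I2 zero_le_power sum_nonneg simp: f_def)
  moreover have "(\<Sum>a<D. \<Sum>e<D. (cmod (\<Sum>b<D. block_tensor D s V a b * Y b e))\<^sup>2) = (\<Sum>e<D. f e V)" for V
    unfolding f_def by (rule sum.swap)
  moreover have "(\<Sum>b<D. \<Sum>e<D. (cmod (Y b e))\<^sup>2) = (\<Sum>e<D. \<Sum>b<D. (cmod (Y b e))\<^sup>2)" by (rule sum.swap)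
  ultimately show ?thesis by (simp add: ennreal_leI)
qed

section \<open>Integrating out independent superblocks one at a time\<close>

locale haar_superblocks =
  fixes D :: nat and J :: "nat \<Rightarrow> complex mat" and \<nu> :: "nat \<Rightarrow> complex mat measure"
  assumes haar: "\<And>s. is_haar (D * D) (USp (D * D) (J s)) (\<nu> s)"
    and form: "\<And>s. symplectic_form (D * D) (J s)" and D: "2 \<le> D"
begin

abbreviation chain where
  "chain V \<equiv> matrix_chain D (\<lambda>s. block_tensor D s (V s))"

sublocale product_prob_space \<nu> UNIV
  using is_haarD(1)[OF haar] by (intro product_prob_spaceI) auto

lemma measurable_superblock_entry:
  assumes "s \<in> I" "i < D * D" "j < D * D"
  shows "(\<lambda>V. V s $$ (i, j)) \<in> borel_measurable (PiM I \<nu>)"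
  by (rule measurable_compose[OF measurable_component_singleton[OF assms(1)] haar_measurable_entry[OF haar assms(2,3)]])

lemma measurable_chain:
  assumes "{j..<j + l} \<subseteq> I" "a < D" "b < D"
  shows "(\<lambda>V. chain V j l a b) \<in> borel_measurable (PiM I \<nu>)"
  using assms
proof (induction l arbitrary: j a)
  case (Suc l)
  have j: "j \<in> I" "{Suc j..<Suc j + l} \<subseteq> I" using Suc.prems(1) by auto
  have "(\<lambda>V. block_tensor D j (V j) a c) \<in> borel_measurable (PiM I \<nu>)" if "c < D" for c
    using measurable_superblock_entry[OF j(1)] digit_pair_less[OF Suc.prems(2) that] D
    by (cases "odd j") (auto simp: block_tensor_def)
  moreover have "(\<lambda>V. chain V (Suc j) l c b) \<in> borel_measurable (PiM I \<nu>)" if "c < D" for c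
    using Suc.IH[OF j(2) that Suc.prems(3)] .
  ultimately show ?case by (auto intro!: borel_measurable_sum borel_measurable_times)
qed simp

lemma chain_cong: "(\<And>s. j \<le> s \<Longrightarrow> V s = V' s) \<Longrightarrow> chain V j l a b = chain V' j l a b"
  by (induction l arbitrary: j a) auto

text \<open>With all later superblocks fixed, the first one acts on a constant matrix and costs one
  factor r. The empty chain is the identity, of squared Frobenius norm \<open>D\<close>.\<close>

lemma nn_integral_chain_le:
  assumes k: "0 < k"
  shows "(\<integral>\<^sup>+V. ennreal ((\<Sum>a<D. \<Sum>e<D. (cmod (chain V j l a e))\<^sup>2) ^ k) \<partial>PiM {j..<j + l} \<nu>) \<le>
    ennreal ((\<Prod>i<k. (real D + real i) / (real (D * D) + real i)) ^ l * real D ^ k)"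
proof (induction l arbitrary: j)
  case 0
  have "(\<Sum>a<D. \<Sum>e<D. (cmod (of_bool (a = e)))\<^sup>2) = real D"
  proof -
    have "(\<Sum>a<D. \<Sum>e<D. (cmod (of_bool (a = e)))\<^sup>2) = (\<Sum>a<D. \<Sum>e<D. if a = e then 1 else 0)"
      by (intro sum.cong refl) auto
    thus ?thesis by simp
  qed
  thus ?case by (simp add: emeasure_space_1 PiM_empty)
next
  case (Suc l)
  define r where "r = (\<Prod>i<k. (real D + real i) / (real (D * D) + real i))"
  have r: "0 \<le> r" unfolding r_def by (intro prod_nonneg) auto
  have ins: "{j..<j + Suc l} = insert j {Suc j..<Suc j + l}" by auto
  have meas: "(\<lambda>V. ennreal ((\<Sum>a<D. \<Sum>e<D. (cmod (chain V j n a e))\<^sup>2) ^ k)) \<in> borel_measurable (PiM I \<nu>)"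
    if "{j..<j + n} \<subseteq> I" for I j n
    using measurable_chain[OF that]
    by (intro measurable_compose[OF _ measurable_ennreal] borel_measurable_power borel_measurable_sum
        measurable_compose[OF _ borel_measurable_norm]) auto
  have "(\<integral>\<^sup>+V. ennreal ((\<Sum>a<D. \<Sum>e<D. (cmod (chain V j (Suc l) a e))\<^sup>2) ^ k) \<partial>PiM {j..<j + Suc l} \<nu>) =
      (\<integral>\<^sup>+V. \<integral>\<^sup>+W. ennreal ((\<Sum>a<D. \<Sum>e<D. (cmod (chain (V(j := W)) j (Suc l) a e))\<^sup>2) ^ k) \<partial>\<nu> j \<partial>PiM {Suc j..<Suc j + l} \<nu>)"
    unfolding ins by (rule product_nn_integral_insert) (auto intro!: meas simp del: matrix_chain.simps)
  also have "\<dots> \<le> (\<integral>\<^sup>+V. ennreal (r * (\<Sum>a<D. \<Sum>e<D. (cmod (chain V (Suc j) l a e))\<^sup>2) ^ k) \<partial>PiM {Suc j..<Suc j + l} \<nu>)"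
  proof (rule nn_integral_mono)
    fix V
    have "chain (V(j := W)) j (Suc l) a e = (\<Sum>b<D. block_tensor D j W a b * chain V (Suc j) l b e)" for W a e
    proof -
      have "chain (V(j := W)) (Suc j) l b e = chain V (Suc j) l b e" for b by (rule chain_cong) auto
      thus ?thesis by simp
    qed
    thus "(\<integral>\<^sup>+W. ennreal ((\<Sum>a<D. \<Sum>e<D. (cmod (chain (V(j := W)) j (Suc l) a e))\<^sup>2) ^ k) \<partial>\<nu> j) \<le>
        ennreal (r * (\<Sum>a<D. \<Sum>e<D. (cmod (chain V (Suc j) l a e))\<^sup>2) ^ k)"
      unfolding r_def using block_tensor_matrix_moment[OF haar form D k, of j j "\<lambda>b e. chain V (Suc j) l b e"] by simp
  qed
  also have "\<dots> = ennreal r * (\<integral>\<^sup>+V. ennreal ((\<Sum>a<D. \<Sum>e<D. (cmod (chain V (Suc j) l a e))\<^sup>2) ^ k) \<partial>PiM {Suc j..<Suc j + l} \<nu>)"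
    unfolding ennreal_mult'[OF r] by (intro nn_integral_cmult meas) auto
  also have "\<dots> \<le> ennreal r * ennreal (r ^ l * real D ^ k)"
    using Suc.IH[of "Suc j"] by (intro mult_left_mono) (auto simp: r_def)
  also have "\<dots> = ennreal (r ^ Suc l * real D ^ k)"
    using r by (simp add: ennreal_mult[symmetric] mult_ac)
  finally show ?case by (simp add: r_def)
qed

text \<open>The trace is linear in block 0, namely its pairing with the transpose of the remaining
  chain. Its average is therefore exact, and only the other \<open>l\<close> blocks contribute
  factors r.\<close>

lemma nn_integral_trace_le:
  assumes k: "0 < k"
  shows "(\<integral>\<^sup>+V. ennreal (cmod (\<Sum>a<D. chain V 0 (Suc l) a a) ^ (2 * k)) \<partial>PiM {..<Suc l} \<nu>) \<le>
    ennreal ((\<Prod>i<k. real (Suc i) / (real (D * D) + real i)) *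
      ((\<Prod>i<k. (real D + real i) / (real (D * D) + real i)) ^ l * real D ^ k))"
proof -
  define c where "c = (\<Prod>i<k. real (Suc i) / (real (D * D) + real i))"
  have c: "0 \<le> c" unfolding c_def by (intro prod_nonneg) auto
  have N: "3 \<le> D * D" using mult_le_mono[OF D D] by simp
  have ins: "{..<Suc l} = insert 0 {1..<1 + l}" by auto
  have meas: "(\<lambda>V. ennreal ((\<Sum>a<D. \<Sum>e<D. (cmod (chain V 1 l a e))\<^sup>2) ^ k)) \<in> borel_measurable (PiM {1..<1 + l} \<nu>)"
    using measurable_chain[of 1 l "{1..<1 + l}"]
    by (intro measurable_compose[OF _ measurable_ennreal] borel_measurable_power borel_measurable_sum
        measurable_compose[OF _ borel_measurable_norm]) auto
  have "(\<integral>\<^sup>+V. ennreal (cmod (\<Sum>a<D. chain V 0 (Suc l) a a) ^ (2 * k)) \<partial>PiM {..<Suc l} \<nu>) =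
      (\<integral>\<^sup>+V. \<integral>\<^sup>+W. ennreal (cmod (\<Sum>a<D. chain (V(0 := W)) 0 (Suc l) a a) ^ (2 * k)) \<partial>\<nu> 0 \<partial>PiM {1..<1 + l} \<nu>)"
    unfolding ins
  proof (rule product_nn_integral_insert)
    show "(\<lambda>V. ennreal (cmod (\<Sum>a<D. chain V 0 (Suc l) a a) ^ (2 * k))) \<in> borel_measurable (PiM (insert 0 {1..<1 + l}) \<nu>)"
    proof -
      have "{0..<0 + Suc l} \<subseteq> insert 0 {1..<1 + l}" by auto
      from measurable_chain[OF this] show ?thesis
      by (intro measurable_compose[OF _ measurable_ennreal] borel_measurable_power
        measurable_compose[OF _ borel_measurable_norm] borel_measurable_sum)
          (simp_all del: matrix_chain.simps)
    qed
  qed auto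
  also have "\<dots> = (\<integral>\<^sup>+V. ennreal c * ennreal ((\<Sum>a<D. \<Sum>e<D. (cmod (chain V 1 l a e))\<^sup>2) ^ k) \<partial>PiM {1..<1 + l} \<nu>)"
  proof (intro nn_integral_cong)
    fix V
    have e: "(\<Sum>a<D. chain (V(0 := W)) 0 (Suc l) a a) = (\<Sum>a<D. \<Sum>b<D. block_tensor D 0 W a b * chain V 1 l b a)" for W
    proof -
      have "chain (V(0 := W)) (Suc 0) l b e = chain V (Suc 0) l b e" for b e by (rule chain_cong) auto
      thus ?thesis by simp
    qed
    have "bounded_measurable (\<nu> 0) (\<lambda>W. cmod (\<Sum>a<D. \<Sum>b<D. block_tensor D 0 W a b * chain V 1 l b a) ^ (2 * k))"
      by (intro bounded_measurable_power bounded_measurable_complex bounded_measurable_sum bounded_measurable_mult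
          bounded_measurable_const bounded_measurable_block_tensor[OF haar]) auto
    from M.bounded_measurable_integrable[OF this]
    have "(\<integral>\<^sup>+W. ennreal (cmod (\<Sum>a<D. chain (V(0 := W)) 0 (Suc l) a a) ^ (2 * k)) \<partial>\<nu> 0) =
        ennreal (\<integral>W. cmod (\<Sum>a<D. \<Sum>b<D. block_tensor D 0 W a b * chain V 1 l b a) ^ (2 * k) \<partial>\<nu> 0)"
      unfolding e by (intro nn_integral_eq_integral) simp_all
    also have "\<dots> = ennreal (c * (\<Sum>a<D. \<Sum>b<D. (cmod (chain V 1 l b a))\<^sup>2) ^ k)"
      unfolding block_tensor_moment[OF haar form D] haar_zero_amplitude_moment[OF haar form N] c_def ..
    also have "(\<Sum>a<D. \<Sum>b<D. (cmod (chain V 1 l b a))\<^sup>2) = (\<Sum>a<D. \<Sum>e<D. (cmod (chain V 1 l a e))\<^sup>2)"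
      by (rule sum.swap)
    finally show "(\<integral>\<^sup>+W. ennreal (cmod (\<Sum>a<D. chain (V(0 := W)) 0 (Suc l) a a) ^ (2 * k)) \<partial>\<nu> 0) =
        ennreal c * ennreal ((\<Sum>a<D. \<Sum>e<D. (cmod (chain V 1 l a e))\<^sup>2) ^ k)"
      by (simp add: ennreal_mult'[OF c])
  qed
  also have "\<dots> = ennreal c * (\<integral>\<^sup>+V. ennreal ((\<Sum>a<D. \<Sum>e<D. (cmod (chain V 1 l a e))\<^sup>2) ^ k) \<partial>PiM {1..<1 + l} \<nu>)"
    by (intro nn_integral_cmult meas)
  also have "\<dots> \<le> ennreal c * ennreal ((\<Prod>i<k. (real D + real i) / (real (D * D) + real i)) ^ l * real D ^ k)"
    by (intro mult_left_mono nn_integral_chain_le k) auto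
  also have "\<dots> = ennreal (c * ((\<Prod>i<k. (real D + real i) / (real (D * D) + real i)) ^ l * real D ^ k))"
    by (simp only: ennreal_mult'[OF c])
  finally show ?thesis by (simp add: c_def)
qed

end

lemma sub_label_superblock_less:
  "sub_label (superblock_qubits m \<xi> s) x < 2 ^ \<xi> * 2 ^ \<xi>"
  using sub_label_less[of "superblock_qubits m \<xi> s" x]
  by (simp add: superblock_qubits_def patch_def power_add)

lemma (in haar_superblocks) ensemble_moment_le:
  assumes D\<xi>: "D = 2 ^ \<xi>" and \<xi>: "0 < \<xi>" and m: "even m" "0 < m" and k: "0 < k"
  shows "zero_amplitude_moment (superblock_ensemble m \<xi> \<nu>) k \<le>
    (\<Prod>i<k. real (Suc i) / (real (D * D) + real i)) *
      ((\<Prod>i<k. (real D + real i) / (real (D * D) + real i)) ^ (m - 1) * real D ^ k)"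
proof -
  let ?P = "PiM {..<m} \<nu>"
  have lay: "(\<lambda>V. layer m \<xi> V (filter P [0..<m]) $$ (x, y)) \<in> borel_measurable ?P"
    if "x < 2 ^ (m * \<xi>)" "y < 2 ^ (m * \<xi>)" "P = even \<or> P = odd" for P x y
    unfolding layer_index[OF m(1) \<xi> that]
    by (intro borel_measurable_prod measurable_superblock_entry) (auto simp: D\<xi> sub_label_superblock_less)
  have meas: "two_layer_circuit m \<xi> \<in> ?P \<rightarrow>\<^sub>M mat_space (2 ^ (m * \<xi>))"
  proof (rule measurable_into_mat_space)
    fix i j :: nat assume ij: "i < 2 ^ (m * \<xi>)" "j < 2 ^ (m * \<xi>)"
    show "(\<lambda>V. two_layer_circuit m \<xi> V $$ (i, j)) \<in> borel_measurable ?P"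
      unfolding two_layer_circuit_def mult_mat_index_sum[OF layer_carrier layer_carrier ij]
      using ij by (intro borel_measurable_sum borel_measurable_times lay) auto
  qed (auto simp: two_layer_circuit_def intro!: mult_carrier_mat layer_carrier)
  have ent: "(\<lambda>U. cmod (U $$ (0, 0)) ^ (2 * k)) \<in> borel_measurable (mat_space (2 ^ (m * \<xi>)))"
    by (intro borel_measurable_power measurable_compose[OF measurable_mat_entry borel_measurable_norm]) auto
  have "zero_amplitude_moment (superblock_ensemble m \<xi> \<nu>) k =
      (\<integral>V. cmod (two_layer_circuit m \<xi> V $$ (0, 0)) ^ (2 * k) \<partial>?P)"
    unfolding zero_amplitude_moment_def superblock_ensemble_def by (rule integral_distr[OF meas ent])
  \<comment> \<open>The amplitude moment is nonnegative, so it can be bounded as a nonnegative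
    integral, where Fubini needs only measurability.\<close>
  also have "\<dots> = enn2real (\<integral>\<^sup>+V. ennreal (cmod (two_layer_circuit m \<xi> V $$ (0, 0)) ^ (2 * k)) \<partial>?P)"
    using measurable_compose[OF meas ent] by (intro integral_eq_nn_integral) auto
  also have "\<dots> \<le> (\<Prod>i<k. real (Suc i) / (real (D * D) + real i)) *
      ((\<Prod>i<k. (real D + real i) / (real (D * D) + real i)) ^ (m - 1) * real D ^ k)"
  proof (rule enn2real_leI)
    obtain l where l: "m = Suc l" using m(2) by (cases m) auto
    have "two_layer_circuit m \<xi> V $$ (0, 0) = (\<Sum>a<D. chain V 0 m a a)" for V
      using two_layer_circuit_amplitude[OF m(1) \<xi>, of V] cyclic_sum_eq_trace[OF _ m(2), of D] D
      by (simp add: D\<xi>)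
    thus "(\<integral>\<^sup>+V. ennreal (cmod (two_layer_circuit m \<xi> V $$ (0, 0)) ^ (2 * k)) \<partial>?P) \<le>
      ennreal ((\<Prod>i<k. real (Suc i) / (real (D * D) + real i)) *
      ((\<Prod>i<k. (real D + real i) / (real (D * D) + real i)) ^ (m - 1) * real D ^ k))"
      using nn_integral_trace_le[OF k, of l] by (simp only: l diff_Suc_1)
  qed (intro mult_nonneg_nonneg zero_le_power prod_nonneg; simp)
  finally show ?thesis .
qed

section \<open>Comparison with the Haar moment\<close>

lemma prod_ratio_le_exp:
  fixes x :: real
  assumes "0 < x"
  shows "(\<Prod>i<k. x + real i) \<le> x ^ k * exp (real k ^ 2 / x)"
proof -
  have "(\<Prod>i<k. x + real i) \<le> (\<Prod>i<k. x * exp (real k / x))"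
  proof (rule prod_mono, intro conjI)
    fix i assume "i \<in> {..<k}"
    hence "x + real i \<le> x * (1 + real k / x)" using assms by (simp add: distrib_left)
    also have "\<dots> \<le> x * exp (real k / x)" using assms by (intro mult_left_mono exp_ge_add_one_self) auto
    finally show "x + real i \<le> x * exp (real k / x)" .
  qed (use assms in auto)
  also have "\<dots> = x ^ k * exp (real k ^ 2 / x)"
    by (simp add: power_mult_distrib power2_eq_square exp_of_nat_mult[symmetric])
  finally show ?thesis .
qed

text \<open>Each of the m - 1 factors r loses one \<open>E\<close> against its leading power of
  \<open>D\<close>. One more \<open>E\<close> pays for replacing D^(mk) by the Haar denominator,
  whose correction exp (k^2 / D^m) is at most \<open>E\<close> because D \<le> D^m. The total loss
  is E^m.\<close>

lemma circuit_bound_le: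
  fixes D \<epsilon> :: real
  assumes D: "1 \<le> D" and m: "0 < m" and k: "real k ^ 2 * real m / D \<le> \<epsilon> / 2" and \<epsilon>: "\<epsilon> \<le> 1"
  shows "(\<Prod>i<k. real (Suc i) / (D\<^sup>2 + real i)) *
      ((\<Prod>i<k. (D + real i) / (D\<^sup>2 + real i)) ^ (m - 1) * D ^ k)
    \<le> (1 + \<epsilon>) * (\<Prod>i<k. real (Suc i) / (D ^ m + real i))"
proof -
  define f where "f = (\<Prod>i<k. real (Suc i))"
  define E where "E = exp (real k ^ 2 / D)"
  have f: "f > 0" unfolding f_def by (intro prod_pos) simp
  have D2: "(\<Prod>i<k. D\<^sup>2 + real i) \<ge> D ^ (2 * k)"
  proof -
    have "(\<Prod>i<k. D\<^sup>2) \<le> (\<Prod>i<k. D\<^sup>2 + real i)" using D by (intro prod_mono) auto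
    thus ?thesis by (simp add: power_mult)
  qed
  have D2p: "(\<Prod>i<k. D\<^sup>2 + real i) > 0"
    using D by (intro less_le_trans[OF _ D2]) auto
  have c: "(\<Prod>i<k. real (Suc i) / (D\<^sup>2 + real i)) \<le> f / D ^ (2 * k)"
    unfolding prod_dividef f_def[symmetric] using D2 D2p f D by (intro divide_left_mono mult_pos_pos) auto
  have "(\<Prod>i<k. (D + real i) / (D\<^sup>2 + real i)) \<le> D ^ k * E / D ^ (2 * k)"
    unfolding prod_dividef E_def using D2 D by (intro frac_le prod_ratio_le_exp) auto
  also have "\<dots> = E / D ^ k" using D by (simp add: mult_2 power_add)
  finally have r: "(\<Prod>i<k. (D + real i) / (D\<^sup>2 + real i)) \<le> E / D ^ k" .
  have r0: "0 \<le> (\<Prod>i<k. (D + real i) / (D\<^sup>2 + real i))" using D by (intro prod_nonneg) auto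
  have N: "D ^ m \<ge> D" using D m by (simp add: self_le_power)
  have "(\<Prod>i<k. D ^ m + real i) \<le> (D ^ m) ^ k * exp (real k ^ 2 / D ^ m)"
    using D by (intro prod_ratio_le_exp) auto
  also have "\<dots> \<le> (D ^ m) ^ k * E"
    unfolding E_def using D N by (intro mult_left_mono iffD2[OF exp_le_cancel_iff] divide_left_mono) auto
  finally have H: "(\<Prod>i<k. D ^ m + real i) \<le> D ^ (m * k) * E" by (simp add: power_mult)
  have P: "(\<Prod>i<k. D ^ m + real i) > 0"
  proof (rule prod_pos)
    fix i show "D ^ m + real i > 0" using D zero_less_power[of D m] by linarith
  qed
  have Em: "E ^ m \<le> 1 + \<epsilon>"
  proof -
    define t where "t = real k ^ 2 * real m / D"
    have t: "0 \<le> t" "t \<le> \<epsilon> / 2" using D k by (simp_all add: t_def)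
    hence "t \<le> 1 / 2" using \<epsilon> by simp
    note t = t this
    have "E ^ m = exp t" by (simp add: E_def t_def exp_of_nat_mult[symmetric] mult.commute)
    \<comment> \<open>Since t \<le> 1/2, the quadratic term is at most t, and 1 + 2 t \<le> 1 +
      \<epsilon>; this is why the hypothesis asks for half of \<epsilon>.\<close>
    also have "\<dots> \<le> 1 + t + t\<^sup>2" using t by (intro exp_bound) auto
    also have "t\<^sup>2 \<le> t * 1" unfolding power2_eq_square using t by (intro mult_left_mono) auto
    finally show ?thesis using t by simp
  qed
  have "(\<Prod>i<k. real (Suc i) / (D\<^sup>2 + real i)) * ((\<Prod>i<k. (D + real i) / (D\<^sup>2 + real i)) ^ (m - 1) * D ^ k)
      \<le> f / D ^ (2 * k) * ((E / D ^ k) ^ (m - 1) * D ^ k)"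
    using D f r r0 c by (intro mult_mono power_mono mult_nonneg_nonneg) (auto simp: E_def)
  also have "\<dots> = E ^ m * (f / (D ^ (m * k) * E))"
  proof -
    obtain l where l: "m = Suc l" using m by (cases m) auto
    have "D ^ (2 * k) = D ^ k * D ^ k" by (simp only: mult_2 power_add)
    moreover have "D ^ (m * k) = D ^ k * (D ^ k) ^ l"
      by (simp add: power_add l power_mult[symmetric] mult.commute)
    ultimately show ?thesis using D by (simp add: l E_def power_divide)
  qed
  also have "\<dots> \<le> (1 + \<epsilon>) * (f / (\<Prod>i<k. D ^ m + real i))"
  proof (rule mult_mono[OF Em])
    show "f / (D ^ (m * k) * E) \<le> f / (\<Prod>i<k. D ^ m + real i)"
      using H P f D by (intro divide_left_mono) (auto simp: E_def)
    have "0 \<le> E ^ m" by (simp add: E_def)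
    thus "0 \<le> 1 + \<epsilon>" using Em by linarith
  qed (use f D in \<open>auto simp: E_def\<close>)
  finally show ?thesis by (simp only: prod_dividef f_def)
qed

text \<open>Only 2^\<xi> \<ge> 2 X is needed for X = k^2 n / \<epsilon>. The coefficient 2 / ln 2
  gives 2^\<xi> \<ge> X^2 instead, and X \<ge> 2 turns one factor X into the constant 2, so no
  additive constant is required beside the logarithm.\<close>

lemma patch_size_sufficient:
  fixes \<epsilon> :: real
  assumes X: "2 \<le> real k ^ 2 * real n / \<epsilon>" and \<epsilon>: "0 < \<epsilon>" and m: "m \<le> n"
    and \<xi>: "2 / ln 2 * ln (real k ^ 2 * real n / \<epsilon>) \<le> real \<xi>"
  shows "real k ^ 2 * real m / 2 ^ \<xi> \<le> \<epsilon> / 2"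
proof -
  define X where "X = real k ^ 2 * real n / \<epsilon>"
  have X2: "2 \<le> X" using X by (simp add: X_def)
  have "ln (X\<^sup>2) \<le> real \<xi> * ln 2"
    using \<xi>[folded X_def] X2 by (simp add: ln_realpow field_simps)
  hence "exp (ln (X\<^sup>2)) \<le> exp (real \<xi> * ln 2)" by simp
  hence "X * X \<le> 2 ^ \<xi>" using X2 by (simp add: exp_of_nat_mult power2_eq_square)
  moreover have "2 * X \<le> X * X" using X2 by (intro mult_right_mono) auto
  ultimately have D: "2 * X \<le> 2 ^ \<xi>" by linarith
  have "real k ^ 2 * real m \<le> real k ^ 2 * real n" using m by (intro mult_left_mono) auto
  also have "\<dots> = \<epsilon> / 2 * (2 * X)" using \<epsilon> by (simp add: X_def)
  also have "\<dots> \<le> \<epsilon> / 2 * 2 ^ \<xi>" using D \<epsilon> by (intro mult_left_mono) auto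
  finally show ?thesis by (simp add: field_simps)
qed

theorem theoremS27:
  shows "\<exists>C>0. \<forall>(n::nat) (m::nat) (\<xi>::nat) (k::nat) (\<epsilon>::real)
      (J :: complex mat) (\<mu> :: complex mat measure)
      (JB :: nat \<Rightarrow> complex mat) (\<nu> :: nat \<Rightarrow> complex mat measure).
    n = m * \<xi> \<and> even m \<and> 0 < m \<and> 0 < \<xi> \<and> 0 < k \<and> 0 < \<epsilon> \<and> \<epsilon> \<le> 1 \<and>
    real \<xi> \<ge> C * ln (real k ^ 2 * real n / \<epsilon>) \<and>
    symplectic_form (2 ^ n) J \<and> is_haar (2 ^ n) (USp (2 ^ n) J) \<mu> \<and>
    (\<forall>s<m. symplectic_form (2 ^ (2 * \<xi>)) (JB s) \<and>
            is_haar (2 ^ (2 * \<xi>)) (USp (2 ^ (2 * \<xi>)) (JB s)) (\<nu> s))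
    \<longrightarrow> zero_amplitude_moment (superblock_ensemble m \<xi> \<nu>) k
          \<le> (1 + \<epsilon>) * zero_amplitude_moment \<mu> k"
proof (rule exI[of _ "2 / ln 2 :: real"], intro conjI allI impI; (elim conjE)?)
  fix n m \<xi> k :: nat and \<epsilon> :: real and J \<mu> and JB :: "nat \<Rightarrow> complex mat" and \<nu> :: "nat \<Rightarrow> complex mat measure"
  assume n: "n = m * \<xi>" and m: "even m" "0 < m" and \<xi>: "0 < \<xi>" and k: "0 < k" and \<epsilon>: "0 < \<epsilon>" "\<epsilon> \<le> 1"
    and size: "2 / ln 2 * ln (real k ^ 2 * real n / \<epsilon>) \<le> real \<xi>"
    and J: "symplectic_form (2 ^ n) J" and \<mu>: "is_haar (2 ^ n) (USp (2 ^ n) J) \<mu>"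
    and blocks: "\<forall>s<m. symplectic_form (2 ^ (2 * \<xi>)) (JB s) \<and>
            is_haar (2 ^ (2 * \<xi>)) (USp (2 ^ (2 * \<xi>)) (JB s)) (\<nu> s)"
  define D :: nat where "D = 2 ^ \<xi>"
  have DD: "2 ^ (2 * \<xi>) = D * D" by (simp add: D_def mult_2 power_add)
  have D2: "2 \<le> D" using \<xi> self_le_power[of "2::nat" \<xi>] by (simp add: D_def)
  have m2: "2 \<le> m" using m by (auto elim!: evenE)
  hence n2: "2 \<le> n" "m \<le> n" using n \<xi> mult_le_mono[of 2 m 1 \<xi>] by auto
  \<comment> \<open>The locale asks for Haar blocks at every index, the theorem only supplies those
    below \<open>m\<close>. Padding with copies of block 0 leaves the ensemble unchanged.\<close>
  define JB' \<nu>' where "JB' s = (if s < m then JB s else JB 0)" and "\<nu>' s = (if s < m then \<nu> s else \<nu> 0)" for s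
  interpret haar_superblocks D JB' \<nu>'
    using blocks m(2) D2 by unfold_locales (auto simp: JB'_def \<nu>'_def DD)
  have "superblock_ensemble m \<xi> \<nu> = superblock_ensemble m \<xi> \<nu>'"
    unfolding superblock_ensemble_def by (intro arg_cong3[where f = distr] PiM_cong refl) (simp add: \<nu>'_def)
  hence "zero_amplitude_moment (superblock_ensemble m \<xi> \<nu>) k \<le>
    (\<Prod>i<k. real (Suc i) / ((real D)\<^sup>2 + real i)) *
      ((\<Prod>i<k. (real D + real i) / ((real D)\<^sup>2 + real i)) ^ (m - 1) * real D ^ k)"
    using ensemble_moment_le[OF D_def \<xi> m k] by (simp add: power2_eq_square)
  also have "\<dots> \<le> (1 + \<epsilon>) * (\<Prod>i<k. real (Suc i) / (real D ^ m + real i))"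
  proof (rule circuit_bound_le)
    \<comment> \<open>An even positive \<open>m\<close> forces n \<ge> 2, and with k \<ge> 1 and
      \<epsilon> \<le> 1 the argument of the logarithm is at least 2.\<close>
    have "1 * 2 \<le> (real k)\<^sup>2 * real n" using k n2 by (intro mult_mono) auto
    hence "2 \<le> real k ^ 2 * real n / \<epsilon>"
      using \<epsilon> by (simp add: pos_le_divide_eq) 
    from patch_size_sufficient[OF this \<epsilon>(1) n2(2) size]
    show "(real k)\<^sup>2 * real m / real D \<le> \<epsilon> / 2" by (simp add: D_def)
  qed (use D2 m \<epsilon> in auto)
  also have "(\<Prod>i<k. real (Suc i) / (real D ^ m + real i)) = zero_amplitude_moment \<mu> k"
  proof -
    have "(2::nat) ^ 2 \<le> 2 ^ n" using n2 by (intro power_increasing) auto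
    hence "(3::nat) \<le> 2 ^ n" by simp
    from haar_zero_amplitude_moment[OF \<mu> J this] show ?thesis
      by (simp add: n D_def power_mult[symmetric] mult.commute)
  qed
  finally show "zero_amplitude_moment (superblock_ensemble m \<xi> \<nu>) k \<le> (1 + \<epsilon>) * zero_amplitude_moment \<mu> k" .
qed simp

end
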